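(* Let $C$ be the non-complete intersection Gorenstein monomial curve $x_i=t^{n_i}$ ($1\le i\le4$) in $\mathbb{A}^4(K)$, with $n_1<n_2<n_3<n_4$. Suppose that $I(C)$ is given as in case 2(a), i.e. $I(C)$ is minimally generated by $$f_1=x_1^{a_1}-x_2^{a_{12}}x_3^{a_{13}},\quad f_2=x_2^{a_2}-x_3^{a_{23}}x_4^{a_{24}},\quad f_3=x_3^{a_3}-x_1^{a_{31}}x_4^{a_{34}},$$ $$f_4=x_4^{a_4}-x_1^{a_{41}}x_2^{a_{42}},\quad f_5=x_1^{a_{41}}x_3^{a_{23}}-x_2^{a_{12}}x_4^{a_{34}}.$$ Then $C$ has Cohen-Macaulay tangent cone at the origin if and only if (1) $a_3\le a_{31}+a_{34}$, (2) $a_{12}+a_{34}\le a_{41}+a_{23}$, and (3) for every monomial $M=x_2^{u_2}x_3^{u_3}x_4^{u_4}$, where $u_2\ge a_2$, $u_3<a_{13}$ and $u_4<a_{34}$, with $u_2n_2+u_3n_3+u_4n_4\in n_1+\mathcal{S}$, there exists a monomial $N$ with $1\in\mathrm{supp}(N)$ such that $M-N\in I(C)$ and $\deg(M)\le\deg(N)$.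
   Context: $K$ is a field and $n_1,\dots,n_4$ are positive integers with $\gcd(n_1,\dots,n_4)=1$. $\mathbb{N}$ denotes the non-negative integers (exponents $u_i$ are in $\mathbb{N}$), $\mathcal{S}=\{g_1n_1+\cdots+g_4n_4: g_i\in\mathbb{N}\}$ and $n_1+\mathcal{S}=\{n_1+m:m\in\mathcal{S}\}$. $I(C)$ is the kernel of the $K$-algebra homomorphism $K[x_1,\dots,x_4]\to K[t]$, $x_i\mapsto t^{n_i}$. $C$ is Gorenstein if $\mathcal{S}$ is symmetric. For a monomial, $\deg(x_1^{u_1}\cdots x_4^{u_4})=u_1+\cdots+u_4$, and $\mathrm{supp}$ is the set of indices $i$ such that $x_i$ divides it. In the description of $I(C)$, all exponents are integers with $0<a_{ij}<a_j$, and (by Bresinsky) $a_1=a_{31}+a_{41}$, $a_2=a_{12}+a_{42}$, $a_3=a_{13}+a_{23}$, $a_4=a_{24}+a_{34}$. $C$ has Cohen-Macaulay tangent cone at the origin if the ring $K[x_1,\dots,x_4]/I(C)_*$ is Cohen-Macaulay, where $I(C)_*$ is generated by the homogeneous (standard grading) summands $f_*$ of least degree of the polynomials $f\in I(C)$. *)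

theory Defs
  imports
    "HOL-Library.Poly_Mapping"
    "HOL-Library.Numeral_Type"
    "HOL-Library.Extended_Nat"
    "HOL-Computational_Algebra.Polynomial"
    "HOL-Algebra.QuotRing"
    "HOL-Algebra.Ring_Divisibility"
    "HOL-Algebra.Algebraic_Closure_Type"
begin

section \<open>Cohen-Macaulay rings and complete intersections\<close>

text \<open>
  The condition \<open>Idl (set xs) \<noteq> carrier R\<close> is the usual requirement that the quotient by
  the whole sequence is nonzero.
\<close>

definition regular_sequence :: "('a, 'b) ring_scheme \<Rightarrow> 'a list \<Rightarrow> bool" where
  "regular_sequence R xs \<longleftrightarrow>
     set xs \<subseteq> carrier R \<and> Idl\<^bsub>R\<^esub> (set xs) \<noteq> carrier R \<and>
     (\<forall>i<length xs. \<forall>y\<in>carrier R.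
        xs ! i \<otimes>\<^bsub>R\<^esub> y \<in> Idl\<^bsub>R\<^esub> (set (take i xs)) \<longrightarrow> y \<in> Idl\<^bsub>R\<^esub> (set (take i xs)))"

definition ideal_depth :: "('a, 'b) ring_scheme \<Rightarrow> 'a set \<Rightarrow> enat" where
  "ideal_depth R I = Sup {enat (length xs) | xs. regular_sequence R xs \<and> set xs \<subseteq> I}"

definition prime_height :: "('a, 'b) ring_scheme \<Rightarrow> 'a set \<Rightarrow> enat" where
  "prime_height R P = Sup {enat k | k. \<exists>Q :: nat \<Rightarrow> 'a set.
     (\<forall>i\<le>k. primeideal (Q i) R) \<and> (\<forall>i<k. Q i \<subset> Q (Suc i)) \<and> Q k = P}"

definition ideal_height :: "('a, 'b) ring_scheme \<Rightarrow> 'a set \<Rightarrow> enat" where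
  "ideal_height R I = Inf {prime_height R P | P. primeideal P R \<and> I \<subseteq> P}"

text \<open>
  A Noetherian commutative ring is Cohen-Macaulay if depth equals height (codimension) at every
  maximal ideal \<open>P\<close>. This is the global form of the definition (Eisenbud, Commutative Algebra,
  18.2), with the depth of \<open>P\<close> on \<open>R\<close>, so that no localizations are needed.
\<close>

definition cohen_macaulay :: "('a, 'b) ring_scheme \<Rightarrow> bool" where
  "cohen_macaulay R \<longleftrightarrow> cring R \<and> noetherian_ring R \<and>
     (\<forall>P. maximalideal P R \<longrightarrow> ideal_depth R P = prime_height R P)"

definition complete_intersection_ideal :: "('a, 'b) ring_scheme \<Rightarrow> 'a set \<Rightarrow> bool" where
  "complete_intersection_ideal R I \<longleftrightarrow>
     (\<exists>F \<subseteq> carrier R. finite F \<and> I = Idl\<^bsub>R\<^esub> F \<and> enat (card F) = ideal_height R I)"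

definition minimally_generates :: "('a, 'b) ring_scheme \<Rightarrow> 'a set \<Rightarrow> 'a set \<Rightarrow> bool" where
  "minimally_generates R F I \<longleftrightarrow>
     F \<subseteq> carrier R \<and> Idl\<^bsub>R\<^esub> F = I \<and> (\<forall>G. G \<subset> F \<longrightarrow> Idl\<^bsub>R\<^esub> G \<noteq> I)"


section \<open>Polynomials in finitely many variables\<close>

text \<open>
  The polynomial ring with variables indexed by a finite type \<open>'i\<close>: a polynomial maps exponent
  vectors to coefficients. For four variables, \<open>'i\<close> is the numeral type \<open>4\<close>, whose elements are
  \<open>1, 2, 3, 4\<close> (with \<open>4 = 0\<close>).
\<close>

type_synonym ('i, 'a) mpoly = "('i \<Rightarrow>\<^sub>0 nat) \<Rightarrow>\<^sub>0 'a"

abbreviation mpoly_ring :: "('i, 'a::comm_ring_1) mpoly ring" where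
  "mpoly_ring \<equiv> ring_of_type_algebra"

definition monomial :: "('i \<Rightarrow>\<^sub>0 nat) \<Rightarrow> ('i, 'a::comm_ring_1) mpoly" where
  "monomial u = Poly_Mapping.single u 1"

definition Var :: "'i \<Rightarrow> ('i, 'a::comm_ring_1) mpoly" where
  "Var i = monomial (Poly_Mapping.single i 1)"

definition mon_deg :: "('i::finite \<Rightarrow>\<^sub>0 nat) \<Rightarrow> nat" where
  "mon_deg u = (\<Sum>i\<in>UNIV. Poly_Mapping.lookup u i)"

definition hom_part :: "nat \<Rightarrow> ('i::finite, 'a::comm_ring_1) mpoly \<Rightarrow> ('i, 'a) mpoly" where
  "hom_part d f = (\<Sum>u | u \<in> Poly_Mapping.keys f \<and> mon_deg u = d.
     Poly_Mapping.single u (Poly_Mapping.lookup f u))"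

text \<open>\<open>initial_form f\<close> is \<open>f\<^sub>*\<close>, the nonzero homogeneous summand of least degree; it is 0 for \<open>f = 0\<close>.\<close>

definition initial_form :: "('i::finite, 'a::comm_ring_1) mpoly \<Rightarrow> ('i, 'a) mpoly" where
  "initial_form f = hom_part (LEAST d. hom_part d f \<noteq> 0) f"

definition initial_ideal :: "('i::finite, 'a::comm_ring_1) mpoly set \<Rightarrow> ('i, 'a) mpoly set" where
  "initial_ideal I = Idl\<^bsub>mpoly_ring\<^esub> (initial_form ` I)"


section \<open>Monomial curves\<close>

text \<open>The substitution \<open>x\<^sub>i \<mapsto> t^(n i)\<close> and its kernel \<open>I(C)\<close>.\<close>

definition curve_hom :: "('i::finite \<Rightarrow> nat) \<Rightarrow> ('i, 'a::field) mpoly \<Rightarrow> 'a poly" where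
  "curve_hom n f = (\<Sum>u\<in>Poly_Mapping.keys f.
     [:Poly_Mapping.lookup f u:] * (\<Prod>i\<in>UNIV. (Polynomial.monom 1 (n i)) ^ Poly_Mapping.lookup u i))"

definition curve_ideal :: "('i::finite \<Rightarrow> nat) \<Rightarrow> ('i, 'a::field) mpoly set" where
  "curve_ideal n = {f. curve_hom n f = 0}"

definition curve_semigroup :: "('i::finite \<Rightarrow> nat) \<Rightarrow> nat set" where
  "curve_semigroup n = {\<Sum>i\<in>UNIV. g i * n i | g. True}"

text \<open>
  Symmetry is tested on all integers, with respect to the largest integer outside \<open>S\<close>
  (which is \<open>-1\<close> if \<open>S\<close> is everything).
\<close>

definition symmetric_semigroup :: "nat set \<Rightarrow> bool" where
  "symmetric_semigroup S \<longleftrightarrow> (\<exists>F::int. F \<notin> int ` S \<and> (\<forall>z>F. z \<in> int ` S) \<and>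
     (\<forall>z. z \<in> int ` S \<longleftrightarrow> F - z \<notin> int ` S))"

definition gorenstein_curve :: "('i::finite \<Rightarrow> nat) \<Rightarrow> bool" where
  "gorenstein_curve n \<longleftrightarrow> symmetric_semigroup (curve_semigroup n)"

text \<open>The semigroup does not see the field, so \<open>'a itself\<close> fixes \<open>K\<close> in the two notions that do.\<close>

definition complete_intersection_curve :: "'a::field itself \<Rightarrow> ('i::finite \<Rightarrow> nat) \<Rightarrow> bool" where
  "complete_intersection_curve K n \<longleftrightarrow>
     complete_intersection_ideal mpoly_ring (curve_ideal n :: ('i, 'a) mpoly set)"

definition cm_tangent_cone :: "'a::field itself \<Rightarrow> ('i::finite \<Rightarrow> nat) \<Rightarrow> bool" where
  "cm_tangent_cone K n \<longleftrightarrow>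
     cohen_macaulay (mpoly_ring Quot (initial_ideal (curve_ideal n :: ('i, 'a) mpoly set)))"

end

theory Submission
  imports Defs
begin

text \<open>
  Why the statement holds. Write \<open>S\<close> for the semigroup, and for an exponent vector \<open>u\<close> let its weight
  be \<open>\<Sum> u\<^sub>i n\<^sub>i\<close>. The tangent cone \<open>A = K[x] / I(C)\<^sub>*\<close> has a very explicit description: a polynomial
  lies in \<open>I(C)\<^sub>*\<close> iff, for every \<open>s\<close>, its coefficients at the longest exponent vectors of weight \<open>s\<close>
  (those of largest degree) add up to zero (\<open>initial_ideal_eq\<close>). So \<open>A\<close> has one basis element for each
  \<open>s\<close> in \<open>S\<close>, and a monomial vanishes in \<open>A\<close> unless it is longest for its weight.

  Since \<open>n\<^sub>1\<close> is the strictly least generator, \<open>x\<^sub>i^n\<^sub>1\<close> is shorter than \<open>x\<^sub>1^n\<^sub>i\<close>, so each \<open>x\<^sub>i\<close> with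
  \<open>i \<noteq> 1\<close> is nilpotent in \<open>A\<close>, while \<open>K[x\<^sub>1]\<close> embeds in \<open>A\<close>: modulo nilpotents, \<open>A\<close> is the affine line.
  Hence every maximal ideal has height one, and no regular sequence has two elements. A polynomial
  in \<open>x\<^sub>1\<close> with nonzero constant term is a nonzerodivisor because \<open>A\<close> is graded, so away from the
  origin the depth is one. At the origin, a nonzerodivisor of the maximal ideal has a power divisible
  by \<open>x\<^sub>1\<close>. Therefore \<open>A\<close> is Cohen-Macaulay iff \<open>x\<^sub>1\<close> is a nonzerodivisor. This argument needs only
  a few properties of \<open>A\<close>, which the locale \<open>thickened_line\<close> isolates (\<open>cohen_macaulay_iff\<close>).

  In terms of exponents, \<open>x\<^sub>1\<close> is a nonzerodivisor iff every monomial without \<open>x\<^sub>1\<close> whose weight lies in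
  \<open>n\<^sub>1 + S\<close> can be exchanged for a monomial of the same weight and at least the same degree that
  contains \<open>x\<^sub>1\<close> (\<open>cm_tangent_cone_iff\<close>).

  It remains to compare this exchange property with the three conditions (\<open>exchange_iff\<close>). Two monomials
  of equal weight are joined by moves along the binomials \<open>f\<^sub>1, \<dots>, f\<^sub>5\<close>, because these generate \<open>I(C)\<close>
  (\<open>saturated_set\<close>). The only monomial other than \<open>x\<^sub>3^a\<^sub>3\<close> of its weight is \<open>x\<^sub>1^a\<^sub>3\<^sub>1 x\<^sub>4^a\<^sub>3\<^sub>4\<close>, and similarly
  for the two terms of \<open>f\<^sub>5\<close>; exchanging these two monomials is what (1) and (2) say. Conversely, the
  order of the \<open>n\<^sub>i\<close> makes \<open>f\<^sub>1\<close> and \<open>f\<^sub>4\<close> exchanges with a gain in degree, and makes the move by \<open>f\<^sub>2\<close>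
  towards \<open>x\<^sub>2^a\<^sub>2\<close> increase the degree. A monomial to which none of these applies is either covered by
  (3) or admits no move at all, and then it is alone in its weight.
\<close>

section \<open>Ideals of commutative rings given by a type\<close>

abbreviation type_ideal :: "'r::comm_ring_1 set \<Rightarrow> bool" where
  "type_ideal T \<equiv> ideal T ring_of_type_algebra"

lemma type_ring_simps [simp]:
  "carrier (ring_of_type_algebra :: 'r::comm_ring_1 ring) = UNIV"
  "a \<oplus>\<^bsub>ring_of_type_algebra\<^esub> b = (a + b :: 'r)"
  "a \<otimes>\<^bsub>ring_of_type_algebra\<^esub> b = (a * b :: 'r)"
  "\<zero>\<^bsub>ring_of_type_algebra\<^esub> = (0 :: 'r)"
  "\<one>\<^bsub>ring_of_type_algebra\<^esub> = (1 :: 'r)"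
  by (simp_all add: ring_of_type_algebra_def)

lemma type_ring_cring: "cring (ring_of_type_algebra :: 'r::comm_ring_1 ring)"
  by (rule cring_from_type_algebra)

lemma type_ring_ring: "ring (ring_of_type_algebra :: 'r::comm_ring_1 ring)"
  by (rule ring_from_type_algebra)

lemma type_ring_uminus [simp]:
  "\<ominus>\<^bsub>ring_of_type_algebra\<^esub> a = (- a :: 'r::comm_ring_1)"
proof -
  interpret cring "ring_of_type_algebra :: 'r ring" by (rule type_ring_cring)
  show ?thesis by (rule minus_equality) simp_all
qed

lemma type_idealI:
  fixes T :: "'r::comm_ring_1 set"
  assumes "0 \<in> T" "\<And>a b. a \<in> T \<Longrightarrow> b \<in> T \<Longrightarrow> a + b \<in> T" "\<And>r a. a \<in> T \<Longrightarrow> r * a \<in> T"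
  shows "type_ideal T"
proof (rule idealI)
  interpret cring "ring_of_type_algebra :: 'r ring" by (rule type_ring_cring)
  show "ring (ring_of_type_algebra :: 'r ring)" by (rule type_ring_ring)
  show "subgroup T (add_monoid ring_of_type_algebra)"
  proof (rule add.subgroupI)
    show "T \<noteq> {}" using assms(1) by auto
    fix a assume "a \<in> T"
    then show "\<ominus>\<^bsub>ring_of_type_algebra\<^esub> a \<in> T" using assms(3)[of a "-1"] by simp
  qed (use assms in auto)
qed (use assms in \<open>auto simp: mult.commute\<close>)

context
  fixes T :: "'r::comm_ring_1 set"
  assumes T: "type_ideal T"
begin

lemma type_ideal_zero: "0 \<in> T"
  using additive_subgroup.zero_closed[OF ideal.axioms(1)[OF T]] by simp

lemma type_ideal_add: "a \<in> T \<Longrightarrow> b \<in> T \<Longrightarrow> a + b \<in> T"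
  using additive_subgroup.a_closed[OF ideal.axioms(1)[OF T]] by simp

lemma type_ideal_mult: "a \<in> T \<Longrightarrow> r * a \<in> T"
  using ideal.I_l_closed[OF T] by simp

lemma type_ideal_mult_right: "a \<in> T \<Longrightarrow> a * r \<in> T"
  using ideal.I_r_closed[OF T] by simp

lemma type_ideal_uminus: "a \<in> T \<Longrightarrow> - a \<in> T"
  using type_ideal_mult[of a "-1"] by simp

lemma type_ideal_diff: "a \<in> T \<Longrightarrow> b \<in> T \<Longrightarrow> a - b \<in> T"
  using type_ideal_add[of a "- b"] type_ideal_uminus by simp

lemma type_ideal_sum: "(\<And>x. x \<in> S \<Longrightarrow> f x \<in> T) \<Longrightarrow> sum f S \<in> T"
  by (induction S rule: infinite_finite_induct) (auto intro: type_ideal_zero type_ideal_add)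

lemma type_ideal_diff_add_cong: "a - b \<in> T \<Longrightarrow> a \<in> T \<longleftrightarrow> b \<in> T"
  using type_ideal_add[of "a - b" b] type_ideal_diff[of a "a - b"] by auto

lemma type_ideal_power_cong:
  assumes "a - b \<in> T"
  shows "a ^ m - b ^ m \<in> T"
proof -
  have "a ^ m - b ^ m = (a - b) * (\<Sum>i<m. b ^ (m - Suc i) * a ^ i)"
    by (rule power_diff_sumr2)
  then show ?thesis using type_ideal_mult_right[OF assms] by metis
qed

lemma type_ideal_coset_eq: "T +>\<^bsub>ring_of_type_algebra\<^esub> a = T +>\<^bsub>ring_of_type_algebra\<^esub> b \<longleftrightarrow> a - b \<in> T"
  using ring.quotient_eq_iff_same_a_r_cos[OF type_ring_ring T, of a b] by (simp add: a_minus_def)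

end

definition ideal_radical :: "'r::comm_ring_1 set \<Rightarrow> 'r set" where
  "ideal_radical T = {r. \<exists>m. r ^ m \<in> T}"

lemma ideal_radical_ideal:
  assumes T: "type_ideal T"
  shows "type_ideal (ideal_radical T)"
proof (rule type_idealI)
  show "0 \<in> ideal_radical T"
    unfolding ideal_radical_def using type_ideal_zero[OF T] by (auto intro: exI[of _ 1])
  fix r a assume "a \<in> ideal_radical T"
  then obtain m where "a ^ m \<in> T" by (auto simp: ideal_radical_def)
  then have "(r * a) ^ m \<in> T" by (simp add: power_mult_distrib type_ideal_mult[OF T])
  then show "r * a \<in> ideal_radical T" by (auto simp: ideal_radical_def)
next
  fix a b assume "a \<in> ideal_radical T" "b \<in> ideal_radical T"
  then obtain k m where k: "a ^ k \<in> T" and m: "b ^ m \<in> T" by (auto simp: ideal_radical_def)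
  have "of_nat ((k + m) choose i) * a ^ i * b ^ (k + m - i) \<in> T" for i
  proof (cases "k \<le> i")
    case True
    then have "a ^ i = a ^ (i - k) * a ^ k" by (simp flip: power_add)
    then show ?thesis using type_ideal_mult[OF T k] type_ideal_mult_right[OF T] type_ideal_mult[OF T] by metis
  next
    case False
    then have "b ^ (k + m - i) = b ^ (k - i) * b ^ m" by (simp flip: power_add)
    then show ?thesis using type_ideal_mult[OF T m] type_ideal_mult[OF T] by metis
  qed
  then have "(a + b) ^ (k + m) \<in> T"
    unfolding binomial_ring by (intro type_ideal_sum[OF T]) auto
  then show "a + b \<in> ideal_radical T" by (auto simp: ideal_radical_def)
qed

lemma Idl_type_ideal: "type_ideal (Idl\<^bsub>ring_of_type_algebra\<^esub> (Y :: 'r::comm_ring_1 set))"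
  using ring.genideal_ideal[OF type_ring_ring] by simp

lemma Idl_type_superset: "Y \<subseteq> Idl\<^bsub>ring_of_type_algebra\<^esub> (Y :: 'r::comm_ring_1 set)"
  using ring.genideal_self[OF type_ring_ring] by simp

lemma Idl_type_minimal:
  "type_ideal T \<Longrightarrow> Y \<subseteq> T \<Longrightarrow> Idl\<^bsub>ring_of_type_algebra\<^esub> (Y :: 'r::comm_ring_1 set) \<subseteq> T"
  by (rule ring.genideal_minimal[OF type_ring_ring])

lemma Idl_type_mono:
  "Y \<subseteq> Z \<Longrightarrow> Idl\<^bsub>ring_of_type_algebra\<^esub> (Y :: 'r::comm_ring_1 set) \<subseteq> Idl\<^bsub>ring_of_type_algebra\<^esub> Z"
  using Idl_type_minimal[OF Idl_type_ideal] Idl_type_superset by (metis subset_trans)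

lemma Idl_type_ideal_eq: "type_ideal T \<Longrightarrow> Idl\<^bsub>ring_of_type_algebra\<^esub> T = (T :: 'r::comm_ring_1 set)"
  using Idl_type_minimal[of T T] Idl_type_superset by blast

text \<open>
  Polynomials over a field form a principal ideal ring: an element of least degree generates. The
  generator may be \<open>0\<close>, so no case distinction is needed when it is used.
\<close>

lemma poly_ideal_principal:
  fixes D :: "'k::field poly set"
  assumes D: "type_ideal D"
  obtains g where "g \<in> D" "\<And>p. p \<in> D \<Longrightarrow> g dvd p"
proof (cases "D \<subseteq> {0}")
  case True
  then show ?thesis using that[of 0] type_ideal_zero[OF D] by auto
next
  case False
  then obtain p0 where "p0 \<in> D \<and> p0 \<noteq> 0" by auto
  then obtain g where g: "g \<in> D" "g \<noteq> 0" and min: "\<And>p. p \<in> D \<Longrightarrow> p \<noteq> 0 \<Longrightarrow> degree g \<le> degree p"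
    using arg_min_natI[of "\<lambda>p. p \<in> D \<and> p \<noteq> 0" p0 degree] arg_min_nat_le[of "\<lambda>p. p \<in> D \<and> p \<noteq> 0" _ degree]
    by blast
  have "g dvd p" if "p \<in> D" for p
  proof -
    have "p mod g = p - (p div g) * g" by (simp add: minus_div_mult_eq_mod)
    then have "p mod g \<in> D" using type_ideal_diff[OF D that type_ideal_mult[OF D g(1)]] by metis
    then have "p mod g = 0"
      using min[of "p mod g"] degree_mod_less'[OF g(2), of p] by linarith
    then show ?thesis by (simp add: dvd_eq_mod_eq_0)
  qed
  then show ?thesis using that g by blast
qed

section \<open>Ideals and regular sequences in a quotient ring\<close>

text \<open>
  Ideals of \<open>R / J\<close> are studied through their preimages in \<open>R\<close>, where arithmetic is that of a type
  class.
\<close>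

abbreviation quot_preimage :: "'r::comm_ring_1 set \<Rightarrow> 'r set set \<Rightarrow> 'r set" where
  "quot_preimage J Q \<equiv> {r. J +>\<^bsub>ring_of_type_algebra\<^esub> r \<in> Q}"

context
  fixes J :: "'r::comm_ring_1 set"
  assumes J: "type_ideal J"
begin

interpretation J: ideal J "ring_of_type_algebra :: 'r ring" by (rule J)
interpretation A: cring "(ring_of_type_algebra :: 'r ring) Quot J"
  by (rule J.quotient_is_cring[OF type_ring_cring])
interpretation h: ring_hom_ring "ring_of_type_algebra :: 'r ring" "(ring_of_type_algebra :: 'r ring) Quot J"
  "\<lambda>r. J +>\<^bsub>ring_of_type_algebra\<^esub> r"
  by (rule J.rcos_ring_hom_ring)

private abbreviation (input) "\<pi> r \<equiv> J +>\<^bsub>ring_of_type_algebra\<^esub> r"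
private abbreviation (input) "R \<equiv> ring_of_type_algebra :: 'r ring"

lemma quot_carrier: "carrier (R Quot J) = range \<pi>"
  by (auto simp: FactRing_def A_RCOSETS_def')

lemma quot_preimage_ideal:
  assumes "ideal Q (R Quot J)"
  shows "type_ideal (quot_preimage J Q)" "J \<subseteq> quot_preimage J Q"
proof -
  interpret Q: ideal Q "R Quot J" by (rule assms)
  show "type_ideal (quot_preimage J Q)"
  proof (rule type_idealI)
    show "0 \<in> quot_preimage J Q"
      using h.hom_zero Q.zero_closed by simp
    fix a b assume "a \<in> quot_preimage J Q" "b \<in> quot_preimage J Q"
    then show "a + b \<in> quot_preimage J Q" using Q.a_closed h.hom_add[of a b] by simp
  next
    fix r a assume "a \<in> quot_preimage J Q"
    then show "r * a \<in> quot_preimage J Q" using Q.I_l_closed[of "\<pi> a" "\<pi> r"] h.hom_mult[of r a] 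
      by (simp add: quot_carrier)
  qed
  show "J \<subseteq> quot_preimage J Q"
  proof
    fix j assume "j \<in> J"
    then have "\<pi> j = \<pi> 0" using type_ideal_coset_eq[OF J] by simp
    then show "j \<in> quot_preimage J Q" using h.hom_zero Q.zero_closed by simp
  qed
qed

lemma quot_image_preimage: "ideal Q (R Quot J) \<Longrightarrow> \<pi> ` quot_preimage J Q = Q"
  using additive_subgroup.a_subset[OF ideal.axioms(1)] by (fastforce simp: quot_carrier)

lemma quot_preimage_image:
  assumes "type_ideal T" "J \<subseteq> T"
  shows "quot_preimage J (\<pi> ` T) = T"
  using type_ideal_coset_eq[OF J] type_ideal_diff_add_cong[OF assms(1)] assms(2) by blast

lemma quot_image_ideal: "type_ideal T \<Longrightarrow> ideal (\<pi> ` T) (R Quot J)"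
  by (rule ring.ring_ideal_imp_quot_ideal[OF type_ring_ring J])

lemma quot_in_Idl_iff:
  "\<pi> r \<in> Idl\<^bsub>R Quot J\<^esub> (\<pi> ` Y) \<longleftrightarrow> r \<in> Idl\<^bsub>R\<^esub> (J \<union> Y)"
proof
  have sub: "\<pi> ` Y \<subseteq> carrier (R Quot J)" by (auto simp: quot_carrier)
  note id = A.genideal_ideal[OF sub]
  have K: "type_ideal (Idl\<^bsub>R\<^esub> (J \<union> Y))" "J \<union> Y \<subseteq> Idl\<^bsub>R\<^esub> (J \<union> Y)"
    by (rule Idl_type_ideal, rule Idl_type_superset)
  show "r \<in> Idl\<^bsub>R\<^esub> (J \<union> Y) \<Longrightarrow> \<pi> r \<in> Idl\<^bsub>R Quot J\<^esub> (\<pi> ` Y)"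
    using Idl_type_minimal[OF quot_preimage_ideal(1)[OF id], of "J \<union> Y"]
      quot_preimage_ideal(2)[OF id] A.genideal_self[OF sub] by blast
  assume "\<pi> r \<in> Idl\<^bsub>R Quot J\<^esub> (\<pi> ` Y)"
  moreover have "Idl\<^bsub>R Quot J\<^esub> (\<pi> ` Y) \<subseteq> \<pi> ` (Idl\<^bsub>R\<^esub> (J \<union> Y))"
    by (rule A.genideal_minimal[OF quot_image_ideal[OF K(1)]]) (use K(2) in auto)
  ultimately show "r \<in> Idl\<^bsub>R\<^esub> (J \<union> Y)"
    using quot_preimage_image[OF K(1)] K(2) by blast
qed

lemma quot_preimage_proper_iff:
  assumes "ideal Q (R Quot J)"
  shows "Q = carrier (R Quot J) \<longleftrightarrow> 1 \<in> quot_preimage J Q"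
  using ideal.one_imp_carrier[OF assms] h.hom_one A.one_closed by auto

lemma quot_prime_iff:
  assumes Q: "ideal Q (R Quot J)"
  shows "primeideal Q (R Quot J) \<longleftrightarrow> 1 \<notin> quot_preimage J Q \<and>
    (\<forall>a b. a * b \<in> quot_preimage J Q \<longrightarrow> a \<in> quot_preimage J Q \<or> b \<in> quot_preimage J Q)"
    (is "_ \<longleftrightarrow> ?r")
proof
  assume "primeideal Q (R Quot J)"
  then interpret Q: primeideal Q "R Quot J" .
  show ?r
    using Q.I_notcarr quot_preimage_proper_iff[OF Q] Q.I_prime h.hom_mult
    by (auto simp: quot_carrier)
next
  assume r: ?r
  show "primeideal Q (R Quot J)"
  proof (rule primeidealI[OF Q A.is_cring])
    show "carrier (R Quot J) \<noteq> Q" using r quot_preimage_proper_iff[OF Q] by blast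
    fix a b assume "a \<in> carrier (R Quot J)" "b \<in> carrier (R Quot J)"
      and ab: "a \<otimes>\<^bsub>R Quot J\<^esub> b \<in> Q"
    then obtain a' b' where "a = \<pi> a'" "b = \<pi> b'" by (auto simp: quot_carrier)
    then show "a \<in> Q \<or> b \<in> Q" using r ab h.hom_mult[of a' b'] by auto
  qed
qed

lemma quot_regular_sequence_iff:
  "regular_sequence (R Quot J) (map \<pi> ys) \<longleftrightarrow>
    1 \<notin> Idl\<^bsub>R\<^esub> (J \<union> set ys) \<and>
    (\<forall>i<length ys. \<forall>r. ys ! i * r \<in> Idl\<^bsub>R\<^esub> (J \<union> set (take i ys)) \<longrightarrow>
      r \<in> Idl\<^bsub>R\<^esub> (J \<union> set (take i ys)))"
proof -
  have sub: "\<pi> ` set ys \<subseteq> carrier (R Quot J)" by (auto simp: quot_carrier)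
  have "Idl\<^bsub>R Quot J\<^esub> (\<pi> ` set ys) = carrier (R Quot J) \<longleftrightarrow> 1 \<in> Idl\<^bsub>R\<^esub> (J \<union> set ys)"
    using quot_preimage_proper_iff[OF A.genideal_ideal[OF sub]] quot_in_Idl_iff by simp
  moreover have "\<pi> (ys ! i) \<otimes>\<^bsub>R Quot J\<^esub> \<pi> r = \<pi> (ys ! i * r)" for i r
    using h.hom_mult by simp
  ultimately show ?thesis
    using sub by (simp add: regular_sequence_def quot_carrier quot_in_Idl_iff flip: set_map take_map)
      (simp add: take_map quot_in_Idl_iff)
qed

lemma quot_regular_sequence_lift:
  assumes "regular_sequence (R Quot J) xs"
  obtains ys where "xs = map \<pi> ys"
  using assms that unfolding regular_sequence_def quot_carrier
  by (metis ex_map_conv image_subset_iff rangeE subsetD)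

end

section \<open>Nilpotent thickenings of the affine line\<close>

lemma cancel_power_mod:
  fixes y :: "'r::comm_ring_1"
  assumes "y ^ m * r \<in> T" and "\<And>r. y * r \<in> T \<Longrightarrow> r \<in> T"
  shows "r \<in> T"
  using assms(1) by (induction m) (simp_all add: assms(2) mult.assoc)

text \<open>
  \<open>R / J\<close> contains \<open>K[X]\<close> by \<open>\<phi>\<close> and equals it up to nilpotents, so its spectrum is the affine line.
  Its only possible defects of depth are at the origin, because \<open>regular_off_origin\<close> makes polynomials
  with nonzero constant term nonzerodivisors. Finiteness over \<open>K[X]\<close> serves to show that \<open>R / J\<close> is
  Noetherian.
\<close>

locale thickened_line =
  fixes J :: "'r::comm_ring_1 set" and \<phi> :: "'k::field poly \<Rightarrow> 'r"
  assumes J: "type_ideal J"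
    and hom_add: "\<phi> (p + q) = \<phi> p + \<phi> q"
    and hom_mult: "\<phi> (p * q) = \<phi> p * \<phi> q"
    and hom_one: "\<phi> 1 = 1"
    and inj: "\<phi> p \<in> J \<Longrightarrow> p = 0"
    and modulo_radical: "\<exists>p. r - \<phi> p \<in> ideal_radical J"
    and regular_off_origin: "coeff p 0 \<noteq> 0 \<Longrightarrow> \<phi> p * r \<in> J \<Longrightarrow> r \<in> J"
    and finite_module: "\<exists>B. finite B \<and> (\<forall>r. \<exists>c. r - (\<Sum>b\<in>B. \<phi> (c b) * b) \<in> J)"
begin

abbreviation "R \<equiv> ring_of_type_algebra :: 'r ring"
abbreviation "\<pi> r \<equiv> J +>\<^bsub>R\<^esub> r"
abbreviation "A \<equiv> R Quot J"
abbreviation "N \<equiv> ideal_radical J"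
abbreviation "pre Q \<equiv> quot_preimage J Q"

lemma hom_zero: "\<phi> 0 = 0"
  using hom_add[of 0 0] by simp

lemma hom_uminus: "\<phi> (- p) = - \<phi> p"
  using hom_add[of p "- p"] hom_zero by (simp add: minus_unique)

lemma hom_diff: "\<phi> (p - q) = \<phi> p - \<phi> q"
  using hom_add[of p "- q"] hom_uminus by simp

lemma hom_power: "\<phi> (p ^ m) = \<phi> p ^ m"
  by (induction m) (simp_all add: hom_one hom_mult)

lemma N: "type_ideal N"
  by (rule ideal_radical_ideal[OF J])

lemma J_subset_N: "J \<subseteq> N"
  unfolding ideal_radical_def by (auto intro: exI[of _ 1])

lemma N_inj: "\<phi> p \<in> N \<Longrightarrow> p = 0"
  unfolding ideal_radical_def using inj[of "p ^ _"] by (auto simp flip: hom_power)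

lemma one_notin_J: "1 \<notin> J"
  using inj[of 1] by (auto simp: hom_one)

lemma vimage_ideal: "type_ideal T \<Longrightarrow> type_ideal {p. \<phi> p \<in> T}"
  by (rule type_idealI)
    (auto simp: hom_zero hom_add hom_mult type_ideal_zero type_ideal_add type_ideal_mult)

lemma N_prime: 
  assumes "a * b \<in> N" shows "a \<in> N \<or> b \<in> N"
proof -
  obtain p q where p: "a - \<phi> p \<in> N" and q: "b - \<phi> q \<in> N"
    using modulo_radical by blast
  have "a * b - \<phi> (p * q) = (a - \<phi> p) * b + \<phi> p * (b - \<phi> q)"
    by (simp add: hom_mult algebra_simps)
  then have "a * b - \<phi> (p * q) \<in> N"
    using type_ideal_add[OF N type_ideal_mult_right[OF N p] type_ideal_mult[OF N q]] by metis
  then have "\<phi> (p * q) \<in> N" using assms type_ideal_diff_add_cong[OF N] by blast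
  then have "p = 0 \<or> q = 0" using N_inj by fastforce
  then show ?thesis using p q by (auto simp: hom_zero)
qed

lemma one_notin_N: "1 \<notin> N"
  using one_notin_J by (simp add: ideal_radical_def)

lemma N_subset_prime:
  assumes "primeideal Q A"
  shows "N \<subseteq> pre Q"
proof
  note Q = primeideal.axioms(1)[OF assms]
  have pr: "1 \<notin> pre Q" "\<And>a b. a * b \<in> pre Q \<Longrightarrow> a \<in> pre Q \<or> b \<in> pre Q"
    using assms quot_prime_iff[OF J Q] by blast+
  fix r assume "r \<in> N"
  then obtain m where "r ^ m \<in> pre Q"
    using quot_preimage_ideal(2)[OF J Q] by (auto simp: ideal_radical_def)
  then show "r \<in> pre Q"
    by (induction m) (use pr in auto)
qed

lemma radical_representative:
  assumes "type_ideal T" "N \<subseteq> T"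
  obtains p where "r - \<phi> p \<in> N" "\<phi> p \<in> T \<longleftrightarrow> r \<in> T"
  using modulo_radical[of r] type_ideal_diff_add_cong[OF assms(1)] assms(2) by blast

lemma N_primeideal: "primeideal (\<pi> ` N) A"
  using quot_prime_iff[OF J quot_image_ideal[OF J N]] quot_preimage_image[OF J N J_subset_N]
    one_notin_N N_prime by auto

text \<open>
  A prime contains the nilpotents, so it is determined by its polynomials. The claim thus reduces to
  the fact that a nonzero prime ideal of \<open>K[X]\<close> is maximal.
\<close>

lemma no_prime_chain_of_length_two:
  assumes prime: "primeideal Q0 A" "primeideal Q1 A" "primeideal Q2 A"
    and strict: "Q0 \<subset> Q1" "Q1 \<subset> Q2"
  shows False
proof -
  note ideals = quot_preimage_ideal(1)[OF J primeideal.axioms(1)[OF prime(2)]]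
    quot_preimage_ideal(1)[OF J primeideal.axioms(1)[OF prime(3)]]
  note sub = N_subset_prime[OF prime(2)] N_subset_prime[OF prime(3)]
  have separate: "\<exists>r. r \<in> pre Q' \<and> r \<notin> pre Q" if "Q \<subset> Q'" "primeideal Q' A" for Q Q'
  proof -
    obtain a where a: "a \<in> Q'" "a \<notin> Q" using \<open>Q \<subset> Q'\<close> by blast
    then have "a \<in> \<pi> ` pre Q'"
      using quot_image_preimage[OF J primeideal.axioms(1)[OF that(2)]] by simp
    then obtain r where "a = \<pi> r" by blast
    then show ?thesis using a by blast
  qed
  obtain r s where r: "r \<in> pre Q1" "r \<notin> pre Q0" and s: "s \<in> pre Q2" "s \<notin> pre Q1"
    using separate[OF strict(1) prime(2)] separate[OF strict(2) prime(3)] by blast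
  obtain p where p: "r - \<phi> p \<in> N" "\<phi> p \<in> pre Q1"
    using radical_representative[OF ideals(1) sub(1), of r thesis] r(1) by blast
  have "p \<noteq> 0"
    using p(1) r(2) N_subset_prime[OF prime(1)] by (auto simp: hom_zero)
  obtain q where q: "\<phi> q \<in> pre Q1 \<longleftrightarrow> s \<in> pre Q1" "s - \<phi> q \<in> N"
    by (rule radical_representative[OF ideals(1) sub(1), of s])
  then have q2: "\<phi> q \<in> pre Q2"
    using s(1) sub(2) type_ideal_diff_add_cong[OF ideals(2)] by blast
  obtain h where h: "\<phi> h \<in> pre Q1" "\<And>p. \<phi> p \<in> pre Q1 \<Longrightarrow> h dvd p"
    using poly_ideal_principal[OF vimage_ideal[OF ideals(1)]] by (metis mem_Collect_eq)
  obtain g where g: "\<phi> g \<in> pre Q2" "\<And>p. \<phi> p \<in> pre Q2 \<Longrightarrow> g dvd p"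
    using poly_ideal_principal[OF vimage_ideal[OF ideals(2)]] by (metis mem_Collect_eq)
  have "h \<noteq> 0" using h(2)[OF p(2)] \<open>p \<noteq> 0\<close> by auto
  have g1: "\<phi> g \<notin> pre Q1"
  proof
    assume "\<phi> g \<in> pre Q1"
    moreover obtain l where "q = g * l" using g(2)[OF q2] by (auto elim: dvdE)
    ultimately have "\<phi> q \<in> pre Q1" using type_ideal_mult_right[OF ideals(1)] by (simp only: hom_mult)
    then show False using q s by simp
  qed
  have "\<phi> h \<in> pre Q2" using h(1) strict by auto
  then obtain k where k: "h = g * k" using g(2) by (auto elim: dvdE)
  have "\<phi> k \<in> pre Q1"
    using h(1) g1 prime(2) quot_prime_iff[OF J primeideal.axioms(1)[OF prime(2)]]
    unfolding k hom_mult by blast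
  then obtain l where "k = h * l" using h(2) by (auto elim: dvdE)
  with k \<open>h \<noteq> 0\<close> have "g * l = 1" by (metis mult.left_commute mult_cancel_left1)
  then have "\<phi> 1 \<in> pre Q2"
    using type_ideal_mult_right[OF ideals(2) g(1)] by (metis hom_mult)
  then show False
    using prime(3) quot_prime_iff[OF J primeideal.axioms(1)[OF prime(3)]] by (simp add: hom_one)
qed

lemma maximal_preimage:
  assumes "maximalideal P A"
  shows "type_ideal (pre P)" "J \<subseteq> pre P" "1 \<notin> pre P" "N \<subseteq> pre P" "primeideal P A"
    and "\<And>T. type_ideal T \<Longrightarrow> pre P \<subseteq> T \<Longrightarrow> T = pre P \<or> 1 \<in> T"
proof -
  note P = maximalideal.axioms(1)[OF assms]
  show pr: "primeideal P A"
    using cring.maximalideal_prime[OF ideal.quotient_is_cring[OF J type_ring_cring] assms] .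
  show pre: "type_ideal (pre P)" "J \<subseteq> pre P" by (rule quot_preimage_ideal[OF J P])+
  show "N \<subseteq> pre P" by (rule N_subset_prime[OF pr])
  show "1 \<notin> pre P" using quot_prime_iff[OF J P] pr by blast
  fix T assume T: "type_ideal T" "pre P \<subseteq> T"
  have T': "pre (\<pi> ` T) = T" using quot_preimage_image[OF J T(1)] pre(2) T(2) by blast
  have PT: "P \<subseteq> \<pi> ` T"
    using image_mono[OF T(2), of \<pi>] quot_image_preimage[OF J P] by simp
  have "\<pi> ` T \<subseteq> carrier A" by (auto simp: quot_carrier[OF J])
  then have "\<pi> ` T = P \<or> \<pi> ` T = carrier A"
    using maximalideal.I_maximal[OF assms quot_image_ideal[OF J T(1)] PT] by simp
  then show "T = pre P \<or> 1 \<in> T"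
    using T' quot_preimage_proper_iff[OF J quot_image_ideal[OF J T(1)]] by metis
qed

text \<open>
  A maximal ideal \<open>P\<close> either contains \<open>x = \<phi> X\<close>, or \<open>x\<close> is invertible modulo \<open>P\<close>; replacing the inverse
  by a polynomial \<open>s\<close>, one finds \<open>1 - s X\<close> in \<open>P\<close>. So no maximal ideal consists of nilpotents only.
\<close>

lemma maximal_contains_polynomial:
  assumes "maximalideal P A"
  obtains p where "p \<noteq> 0" "\<phi> p \<in> pre P"
proof -
  note P = maximal_preimage[OF assms]
  let ?x = "\<phi> [:0, 1:]"
  define T where "T = {a + r * ?x | a r. a \<in> pre P}"
  have T: "type_ideal T"
  proof (rule type_idealI)
    show "0 \<in> T" unfolding T_def using type_ideal_zero[OF P(1)] by (auto intro!: exI[of _ 0])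
    fix u v assume "u \<in> T" "v \<in> T"
    then obtain a r b s where "u = a + r * ?x" "v = b + s * ?x" "a \<in> pre P" "b \<in> pre P"
      unfolding T_def by blast
    then have "u + v = (a + b) + (r + s) * ?x" "a + b \<in> pre P"
      using type_ideal_add[OF P(1)] by (auto simp: algebra_simps)
    then show "u + v \<in> T" unfolding T_def by blast
  next
    fix s u assume "u \<in> T"
    then obtain a r where "u = a + r * ?x" "a \<in> pre P"
      unfolding T_def by blast
    then have "s * u = s * a + (s * r) * ?x" "s * a \<in> pre P"
      using type_ideal_mult[OF P(1)] by (auto simp: algebra_simps)
    then show "s * u \<in> T" unfolding T_def by blast
  qed
  have sub: "pre P \<subseteq> T"
  proof
    fix a assume "a \<in> pre P"
    then have "a + 0 * ?x \<in> T" unfolding T_def by blast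
    then show "a \<in> T" by simp
  qed
  show ?thesis
  proof (cases "1 \<in> T")
    case True
    then obtain a r where a: "1 = a + r * ?x" "a \<in> pre P" unfolding T_def by blast
    obtain s where s: "r - \<phi> s \<in> pre P" using modulo_radical P(4) by blast
    have "\<phi> (1 - s * [:0, 1:]) = a + (r - \<phi> s) * ?x"
      unfolding hom_diff hom_mult hom_one by (subst a(1)) (simp add: algebra_simps)
    also have "\<dots> \<in> pre P"
      by (rule type_ideal_add[OF P(1) a(2) type_ideal_mult_right[OF P(1) s]])
    finally have "\<phi> (1 - s * [:0, 1:]) \<in> pre P" .
    moreover have "coeff (1 - s * [:0, 1:]) 0 \<noteq> 0" by (simp add: coeff_mult)
    then have "1 - s * [:0, 1:] \<noteq> 0" by (metis coeff_0)
    ultimately show ?thesis using that by blast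
  next
    case False
    then have "T = pre P" using P(6)[OF T sub] by blast
    moreover have "0 + 1 * ?x \<in> T" unfolding T_def using type_ideal_zero[OF P(1)] by blast
    ultimately show ?thesis using that[of "[:0, 1:]"] by simp
  qed
qed

text \<open>The nilpotents form a prime ideal below every maximal ideal, and no longer chain exists.\<close>

lemma prime_height_maximal:
  assumes max: "maximalideal P A"
  shows "prime_height A P = 1"
proof -
  note P = maximal_preimage[OF max]
  let ?K = "{enat k | k. \<exists>Q :: nat \<Rightarrow> 'r set set.
     (\<forall>i\<le>k. primeideal (Q i) A) \<and> (\<forall>i<k. Q i \<subset> Q (Suc i)) \<and> Q k = P}"
  have le: "e \<le> 1" if "e \<in> ?K" for e
    using that
  proof (elim CollectE exE conjE)
    fix k and Q :: "nat \<Rightarrow> 'r set set"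
    assume e: "e = enat k" and Q: "\<forall>i\<le>k. primeideal (Q i) A" "\<forall>i<k. Q i \<subset> Q (Suc i)"
    have "k \<le> 1"
    proof (rule ccontr)
      assume "\<not> k \<le> 1"
      then show False
        using no_prime_chain_of_length_two[of "Q 0" "Q 1" "Q 2"] Q
        by (simp add: numeral_2_eq_2)
    qed
    then show "e \<le> 1" unfolding e by (simp add: one_enat_def)
  qed
  have N_sub: "\<pi> ` N \<subset> P"
  proof -
    have "\<pi> ` N \<subseteq> P" using P(4) by auto
    moreover obtain p where "p \<noteq> 0" "\<phi> p \<in> pre P" by (rule maximal_contains_polynomial[OF max])
    moreover have "pre (\<pi> ` N) = N" by (rule quot_preimage_image[OF J N J_subset_N])
    ultimately show ?thesis using N_inj by blast
  qed
  define C where "C = (\<lambda>i::nat. if i = 0 then \<pi> ` N else P)"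
  have "(\<forall>i\<le>1. primeideal (C i) A) \<and> (\<forall>i<1. C i \<subset> C (Suc i)) \<and> C 1 = P"
    using N_sub N_primeideal P(5) by (simp add: C_def)
  then have "enat 1 \<in> ?K" by (intro CollectI exI[of _ "1::nat"] exI[of _ C] conjI refl) (elim conjE, assumption)+
  from Sup_upper[OF this] have "1 \<le> Sup ?K" by (simp only: one_enat_def)
  moreover have "Sup ?K \<le> 1" by (rule Sup_least) (rule le)
  ultimately show ?thesis unfolding prime_height_def by (rule antisym[rotated])
qed

text \<open>
  Let \<open>h\<close> generate the polynomials in \<open>(y\<^sub>1)\<close>; it is nonzero because \<open>y\<^sub>1\<close> is not nilpotent. If \<open>q\<close> is
  the polynomial part of \<open>y\<^sub>2\<close>, then \<open>q\<close> and \<open>h\<close> have a nontrivial common divisor \<open>d\<close>, as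
  \<open>(y\<^sub>1, y\<^sub>2)\<close> is proper. A power of \<open>y\<^sub>2\<close> is a multiple of \<open>q\<close>, hence kills \<open>h / d\<close> modulo \<open>y\<^sub>1\<close>,
  although \<open>h / d\<close> is not in \<open>(y\<^sub>1)\<close>.
\<close>

lemma no_regular_sequence_of_length_two:
  assumes proper: "1 \<notin> Idl\<^bsub>R\<^esub> (J \<union> {y1, y2})"
    and reg1: "\<And>r. y1 * r \<in> J \<Longrightarrow> r \<in> J"
    and reg2: "\<And>r. y2 * r \<in> Idl\<^bsub>R\<^esub> (J \<union> {y1}) \<Longrightarrow> r \<in> Idl\<^bsub>R\<^esub> (J \<union> {y1})"
  shows False
proof -
  define I1 where "I1 = Idl\<^bsub>R\<^esub> (J \<union> {y1})"
  define I2 where "I2 = Idl\<^bsub>R\<^esub> (J \<union> {y1, y2})"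
  have I1: "type_ideal I1" "J \<subseteq> I1" "y1 \<in> I1"
    using Idl_type_ideal Idl_type_superset[of "J \<union> {y1}"] unfolding I1_def by auto
  have I2: "type_ideal I2" "J \<subseteq> I2" "y2 \<in> I2"
    using Idl_type_ideal Idl_type_superset[of "J \<union> {y1, y2}"] unfolding I2_def by auto
  have I12: "I1 \<subseteq> I2" unfolding I1_def I2_def by (rule Idl_type_mono) auto
  obtain p where p: "y1 - \<phi> p \<in> N" using modulo_radical by blast
  then obtain m where m: "(y1 - \<phi> p) ^ m \<in> J" by (auto simp: ideal_radical_def)
  have "p \<noteq> 0"
  proof
    assume "p = 0"
    then have "y1 ^ m \<in> J" using m by (simp add: hom_zero)
    then have "1 \<in> J" using cancel_power_mod[of y1 m 1 J] reg1 by simp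
    then show False using one_notin_J by simp
  qed
  \<comment> \<open>\<open>\<phi> p\<close> is congruent to a nilpotent modulo \<open>y1\<close>, so \<open>p ^ m\<close> is a nonzero polynomial in \<open>(y1)\<close>\<close>
  have "(\<phi> p - y1) ^ m - \<phi> p ^ m \<in> I1"
    by (rule type_ideal_power_cong[OF I1(1)]) (use I1 type_ideal_uminus in auto)
  moreover have "(\<phi> p - y1) ^ m = (-1) ^ m * (y1 - \<phi> p) ^ m"
    by (simp flip: power_mult_distrib)
  then have "(\<phi> p - y1) ^ m \<in> I1" using m I1(2) type_ideal_mult[OF J] by auto
  ultimately have pm: "\<phi> (p ^ m) \<in> I1"
    using type_ideal_diff_add_cong[OF I1(1)] by (simp add: hom_power)
  obtain h where h: "\<phi> h \<in> I1" "\<And>p. \<phi> p \<in> I1 \<Longrightarrow> h dvd p"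
    using poly_ideal_principal[OF vimage_ideal[OF I1(1)]] by (metis mem_Collect_eq)
  have "h \<noteq> 0" using h(2)[OF pm] \<open>p \<noteq> 0\<close> by auto
  obtain q where q: "y2 - \<phi> q \<in> N" using modulo_radical by blast
  then obtain k where k: "(y2 - \<phi> q) ^ k \<in> J" by (auto simp: ideal_radical_def)
  define D where "D = {u * h + v * q | u v. True}"
  have D: "type_ideal D"
  proof (rule type_idealI)
    show "0 \<in> D" unfolding D_def by (auto intro!: exI[of _ 0])
  next
    fix a b assume "a \<in> D" "b \<in> D"
    then obtain u v u' v' where "a = u * h + v * q" "b = u' * h + v' * q" unfolding D_def by blast
    then have "a + b = (u + u') * h + (v + v') * q" by (simp add: algebra_simps)
    then show "a + b \<in> D" unfolding D_def by blast
  next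
    fix r a assume "a \<in> D"
    then obtain u v where "a = u * h + v * q" unfolding D_def by blast
    then have "r * a = (r * u) * h + (r * v) * q" by (simp add: algebra_simps)
    then show "r * a \<in> D" unfolding D_def by blast
  qed
  obtain d where d: "d \<in> D" "\<And>p. p \<in> D \<Longrightarrow> d dvd p"
    using poly_ideal_principal[OF D] by metis
  have "1 * h + 0 * q \<in> D" "0 * h + 1 * q \<in> D" unfolding D_def by blast+
  then have "d dvd h" "d dvd q" using d(2) by simp_all
  then obtain h' q' where h': "h = d * h'" and q': "q = d * q'" by (auto elim!: dvdE)
  \<comment> \<open>as the gcd of \<open>h\<close> and \<open>q\<close>, \<open>d\<close> is not a unit\<close>
  have "\<not> d dvd 1"
  proof
    assume "d dvd 1"
    then have "1 \<in> D" using type_ideal_mult_right[OF D d(1)] by (metis dvd_def)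
    then obtain u v where uv: "1 = u * h + v * q" unfolding D_def by blast
    have "(\<phi> q - y2) ^ k - \<phi> q ^ k \<in> I2"
      by (rule type_ideal_power_cong[OF I2(1)]) (use I2 type_ideal_uminus in auto)
    moreover have "(\<phi> q - y2) ^ k = (-1) ^ k * (y2 - \<phi> q) ^ k"
      by (simp flip: power_mult_distrib)
    then have "(\<phi> q - y2) ^ k \<in> I2" using k I2(2) type_ideal_mult[OF J] by auto
    ultimately have "\<phi> q ^ k \<in> I2" using type_ideal_diff_add_cong[OF I2(1)] by blast
    then have "\<phi> (v * q) ^ k \<in> I2"
      by (simp add: hom_mult power_mult_distrib type_ideal_mult[OF I2(1)])
    moreover have "1 ^ k - \<phi> (v * q) ^ k \<in> I2"
    proof (rule type_ideal_power_cong[OF I2(1)])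
      have "1 - \<phi> (v * q) = \<phi> u * \<phi> h"
        by (subst hom_one[symmetric], subst uv) (simp add: hom_add hom_mult)
      then show "1 - \<phi> (v * q) \<in> I2"
        using h(1) I12 type_ideal_mult[OF I2(1)] by auto
    qed
    ultimately have "1 \<in> I2" using type_ideal_diff_add_cong[OF I2(1)] by simp
    then show False using proper unfolding I2_def by simp
  qed
  have "(y2 ^ k - (y2 - \<phi> q) ^ k) * \<phi> h' \<in> I1"
  proof -
    obtain w where "y2 ^ k - (y2 - \<phi> q) ^ k = \<phi> q * w"
      using power_diff_sumr2[of y2 k "y2 - \<phi> q"] by auto
    then have "(y2 ^ k - (y2 - \<phi> q) ^ k) * \<phi> h' = \<phi> h * (\<phi> q' * w)"
      unfolding h' q' hom_mult by (simp add: algebra_simps)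
    then show ?thesis using type_ideal_mult_right[OF I1(1) h(1)] by simp
  qed
  moreover have "(y2 - \<phi> q) ^ k * \<phi> h' \<in> I1"
    using k I1 type_ideal_mult_right[OF I1(1)] by blast
  ultimately have "y2 ^ k * \<phi> h' \<in> I1"
    using type_ideal_add[OF I1(1)] by (fastforce simp: algebra_simps)
  then have "\<phi> h' \<in> I1"
    unfolding I1_def by (rule cancel_power_mod) (rule reg2)
  then have "h dvd h'" by (rule h(2))
  then show False
    using \<open>\<not> d dvd 1\<close> \<open>h \<noteq> 0\<close> unfolding h' using dvd_mult_cancel_right[of d h' 1] by auto
qed

text \<open>
  The submodule argument over the principal ideal ring \<open>K[X]\<close>: the coefficients of \<open>b\<close> that occur in
  elements of \<open>T\<close> form a principal ideal, and subtracting a multiple of an element \<open>z\<close> that realises its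
  generator removes \<open>b\<close>.
\<close>

lemma finitely_generated_in_span:
  assumes "finite B" and T: "type_ideal T" "J \<subseteq> T"
  shows "\<exists>Y. finite Y \<and> Y \<subseteq> T \<and>
    (\<forall>r\<in>T. (\<exists>c. r - (\<Sum>b\<in>B. \<phi> (c b) * b) \<in> J) \<longrightarrow> r \<in> Idl\<^bsub>R\<^esub> (J \<union> Y))"
  using assms(1)
proof (induction B)
  case empty
  then show ?case using Idl_type_superset[of J] by (intro exI[of _ "{}"]) auto
next
  case (insert b B)
  then obtain Y where Y: "finite Y" "Y \<subseteq> T"
    and YI: "\<And>r c. r \<in> T \<Longrightarrow> r - (\<Sum>b\<in>B. \<phi> (c b) * b) \<in> J \<Longrightarrow> r \<in> Idl\<^bsub>R\<^esub> (J \<union> Y)"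
    by blast
  define D where "D = {p. \<exists>r c. r \<in> T \<and> r - \<phi> p * b - (\<Sum>b\<in>B. \<phi> (c b) * b) \<in> J}"
  have D: "type_ideal D"
  proof (rule type_idealI)
    show "0 \<in> D" unfolding D_def
      by (intro CollectI exI[of _ 0] exI[of _ "\<lambda>_. 0"])
        (simp add: hom_zero type_ideal_zero[OF T(1)] type_ideal_zero[OF J])
  next
    fix p q assume "p \<in> D" "q \<in> D"
    then obtain r c s d where *: "r \<in> T" "s \<in> T"
      "r - \<phi> p * b - (\<Sum>b\<in>B. \<phi> (c b) * b) \<in> J" "s - \<phi> q * b - (\<Sum>b\<in>B. \<phi> (d b) * b) \<in> J"
      unfolding D_def by blast
    have "(r + s) - \<phi> (p + q) * b - (\<Sum>b\<in>B. \<phi> (c b + d b) * b)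
       = (r - \<phi> p * b - (\<Sum>b\<in>B. \<phi> (c b) * b)) + (s - \<phi> q * b - (\<Sum>b\<in>B. \<phi> (d b) * b))"
      by (simp add: hom_add algebra_simps sum.distrib)
    then have "(r + s) - \<phi> (p + q) * b - (\<Sum>b\<in>B. \<phi> (c b + d b) * b) \<in> J"
      using type_ideal_add[OF J *(3,4)] by (simp only:)
    then show "p + q \<in> D"
      unfolding D_def using type_ideal_add[OF T(1) *(1,2)]
      by (intro CollectI exI[of _ "r + s"] exI[of _ "\<lambda>b. c b + d b"]) simp
  next
    fix l p assume "p \<in> D"
    then obtain r c where *: "r \<in> T" "r - \<phi> p * b - (\<Sum>b\<in>B. \<phi> (c b) * b) \<in> J"
      unfolding D_def by blast
    have "\<phi> l * r - \<phi> (l * p) * b - (\<Sum>b\<in>B. \<phi> (l * c b) * b)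
       = \<phi> l * (r - \<phi> p * b - (\<Sum>b\<in>B. \<phi> (c b) * b))"
      by (simp add: hom_mult algebra_simps sum_distrib_left)
    then have "\<phi> l * r - \<phi> (l * p) * b - (\<Sum>b\<in>B. \<phi> (l * c b) * b) \<in> J"
      using type_ideal_mult[OF J *(2)] by (simp only:)
    then show "l * p \<in> D"
      unfolding D_def using type_ideal_mult[OF T(1) *(1)]
      by (intro CollectI exI[of _ "\<phi> l * r"] exI[of _ "\<lambda>b. l * c b"]) simp
  qed
  obtain g where g: "g \<in> D" "\<And>p. p \<in> D \<Longrightarrow> g dvd p"
    using poly_ideal_principal[OF D] by metis
  obtain z d where z: "z \<in> T" "z - \<phi> g * b - (\<Sum>b\<in>B. \<phi> (d b) * b) \<in> J"
    using g(1) unfolding D_def by blast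
  have "r \<in> Idl\<^bsub>R\<^esub> (J \<union> insert z Y)"
    if r: "r \<in> T" and c: "r - (\<Sum>b\<in>insert b B. \<phi> (c b) * b) \<in> J" for r c
  proof -
    have c': "r - \<phi> (c b) * b - (\<Sum>b\<in>B. \<phi> (c b) * b) \<in> J"
      using c insert.hyps by (simp add: diff_diff_eq)
    then have "c b \<in> D" using r unfolding D_def by blast
    then obtain l where l: "c b = g * l" using g(2) by (auto elim: dvdE)
    have "(r - \<phi> l * z) - (\<Sum>b\<in>B. \<phi> (c b - l * d b) * b)
       = (r - \<phi> (c b) * b - (\<Sum>b\<in>B. \<phi> (c b) * b))
         - \<phi> l * (z - \<phi> g * b - (\<Sum>b\<in>B. \<phi> (d b) * b))"
      by (simp add: l hom_diff hom_mult algebra_simps sum_distrib_left sum_subtractf)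
    also have "\<dots> \<in> J" by (rule type_ideal_diff[OF J c' type_ideal_mult[OF J z(2)]])
    finally have "(r - \<phi> l * z) - (\<Sum>b\<in>B. \<phi> (c b - l * d b) * b) \<in> J" .
    then have "r - \<phi> l * z \<in> Idl\<^bsub>R\<^esub> (J \<union> Y)"
      by (rule YI[OF type_ideal_diff[OF T(1) r type_ideal_mult[OF T(1) z(1)]]])
    moreover have "Idl\<^bsub>R\<^esub> (J \<union> Y) \<subseteq> Idl\<^bsub>R\<^esub> (J \<union> insert z Y)"
      by (rule Idl_type_mono) auto
    moreover have "z \<in> Idl\<^bsub>R\<^esub> (J \<union> insert z Y)"
      using Idl_type_superset[of "J \<union> insert z Y"] by auto
    ultimately have "(r - \<phi> l * z) + \<phi> l * z \<in> Idl\<^bsub>R\<^esub> (J \<union> insert z Y)"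
      by (intro type_ideal_add[OF Idl_type_ideal] type_ideal_mult[OF Idl_type_ideal]) auto
    then show ?thesis by simp
  qed
  then have "\<forall>r\<in>T. (\<exists>c. r - (\<Sum>b\<in>insert b B. \<phi> (c b) * b) \<in> J) \<longrightarrow>
      r \<in> Idl\<^bsub>R\<^esub> (J \<union> insert z Y)"
    by (intro ballI impI) (elim exE)
  moreover have "finite (insert z Y)" "insert z Y \<subseteq> T" using Y z(1) by simp_all
  ultimately show ?case by (intro exI[of _ "insert z Y"] conjI)
qed

lemma noetherian: "noetherian_ring A"
proof (rule noetherian_ring.intro)
  interpret A: ring A by (rule ideal.quotient_is_ring[OF J])
  show "ring A" by (rule A.ring_axioms)
  show "noetherian_ring_axioms A"
  proof
    fix Q assume Q: "ideal Q A"
    note T = quot_preimage_ideal[OF J Q]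
    obtain B where B: "finite B" "\<And>r. \<exists>c. r - (\<Sum>b\<in>B. \<phi> (c b) * b) \<in> J"
      using finite_module by blast
    obtain Y where Y: "finite Y" "Y \<subseteq> pre Q" "pre Q \<subseteq> Idl\<^bsub>R\<^esub> (J \<union> Y)"
      using finitely_generated_in_span[OF B(1) T] B(2) by blast
    have "Idl\<^bsub>R\<^esub> (J \<union> Y) \<subseteq> pre Q" by (rule Idl_type_minimal[OF T(1)]) (use T(2) Y(2) in blast)
    with Y(3) have "pre Q = Idl\<^bsub>R\<^esub> (J \<union> Y)" by blast
    moreover have sub: "\<pi> ` Y \<subseteq> carrier A" by (auto simp: quot_carrier[OF J])
    moreover have "pre (Idl\<^bsub>A\<^esub> (\<pi> ` Y)) = Idl\<^bsub>R\<^esub> (J \<union> Y)"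
      using quot_in_Idl_iff[OF J] by blast
    ultimately have "Q = Idl\<^bsub>A\<^esub> (\<pi> ` Y)"
      using quot_image_preimage[OF J Q] quot_image_preimage[OF J A.genideal_ideal[OF sub]] by metis
    then show "\<exists>S\<subseteq>carrier A. finite S \<and> Q = Idl\<^bsub>A\<^esub> S" using sub Y(1) by blast
  qed
qed

lemma regular_polynomial:
  assumes x: "\<And>r. \<phi> [:0, 1:] * r \<in> J \<Longrightarrow> r \<in> J"
  shows "p \<noteq> 0 \<Longrightarrow> \<phi> p * r \<in> J \<Longrightarrow> r \<in> J"
proof (induction p)
  case (pCons c p)
  show ?case
  proof (cases "c = 0")
    case True
    then have "pCons c p = [:0, 1:] * p" by simp
    then have "\<phi> [:0, 1:] * (\<phi> p * r) \<in> J" using pCons.prems by (metis hom_mult mult.assoc)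
    then show ?thesis using x pCons True by auto
  next
    case False
    then show ?thesis using regular_off_origin[of "pCons c p" r] pCons.prems by simp
  qed
qed simp

text \<open>If \<open>x\<close> is a nonzerodivisor, so is every nonzero polynomial, and every maximal ideal contains one.\<close>

lemma depth_maximal:
  assumes x: "\<And>r. \<phi> [:0, 1:] * r \<in> J \<Longrightarrow> r \<in> J" and max: "maximalideal P A"
  shows "ideal_depth A P = 1"
proof -
  note P = maximal_preimage[OF max]
  have "e \<le> 1" if e: "e \<in> {enat (length xs) | xs. regular_sequence A xs \<and> set xs \<subseteq> P}" for e
  proof -
    obtain xs where e: "e = enat (length xs)" and xs: "regular_sequence A xs" using e by blast
    obtain ys where ys: "xs = map \<pi> ys" by (rule quot_regular_sequence_lift[OF J xs])
    have reg: "1 \<notin> Idl\<^bsub>R\<^esub> (J \<union> set ys)"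
      "\<And>i r. i < length ys \<Longrightarrow> ys ! i * r \<in> Idl\<^bsub>R\<^esub> (J \<union> set (take i ys)) \<Longrightarrow>
        r \<in> Idl\<^bsub>R\<^esub> (J \<union> set (take i ys))"
      using xs unfolding ys quot_regular_sequence_iff[OF J] by blast+
    have "length ys \<le> 1"
    proof (rule ccontr)
      assume "\<not> length ys \<le> 1"
      then obtain y1 y2 zs where zs: "ys = y1 # y2 # zs"
        by (cases ys; cases "tl ys") auto
      have "Idl\<^bsub>R\<^esub> (J \<union> {y1, y2}) \<subseteq> Idl\<^bsub>R\<^esub> (J \<union> set ys)"
        by (rule Idl_type_mono) (auto simp: zs)
      then have "1 \<notin> Idl\<^bsub>R\<^esub> (J \<union> {y1, y2})" using reg(1) by blast
      then show False
        by (rule no_regular_sequence_of_length_two)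
          (use reg(2)[of 0] reg(2)[of 1] in \<open>auto simp: zs Idl_type_ideal_eq[OF J]\<close>)
    qed
    then show ?thesis by (simp add: e ys one_enat_def)
  qed
  then have "ideal_depth A P \<le> 1" unfolding ideal_depth_def by (rule Sup_least)
  moreover obtain p where p: "p \<noteq> 0" "\<phi> p \<in> pre P" by (rule maximal_contains_polynomial[OF max])
  have "Idl\<^bsub>R\<^esub> (J \<union> {\<phi> p}) \<subseteq> pre P" by (rule Idl_type_minimal[OF P(1)]) (use P(2) p(2) in auto)
  then have "1 \<notin> Idl\<^bsub>R\<^esub> (J \<union> {\<phi> p})" using P(3) by blast
  then have "regular_sequence A (map \<pi> [\<phi> p])"
    unfolding quot_regular_sequence_iff[OF J] using regular_polynomial[OF x p(1)]
    by (auto simp: Idl_type_ideal_eq[OF J])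
  then have "regular_sequence A [\<pi> (\<phi> p)] \<and> set [\<pi> (\<phi> p)] \<subseteq> P" using p(2) by simp
  then have "enat (length [\<pi> (\<phi> p)]) \<in> {enat (length xs) | xs. regular_sequence A xs \<and> set xs \<subseteq> P}"
    by blast
  then have "1 \<le> ideal_depth A P" unfolding ideal_depth_def by (auto simp: one_enat_def intro: Sup_upper)
  ultimately show ?thesis by simp
qed

text \<open>The origin of the line: polynomial part without constant term.\<close>

lemma origin_maximalideal:
  defines "O0 \<equiv> {r. \<exists>p. coeff p 0 = 0 \<and> r - \<phi> p \<in> N}"
  shows "maximalideal (\<pi> ` O0) A" "pre (\<pi> ` O0) = O0"
proof -
  have O0: "type_ideal O0"
  proof (rule type_idealI)
    show "0 \<in> O0" unfolding O0_def
      by (intro CollectI exI[of _ 0]) (simp add: hom_zero type_ideal_zero[OF N])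
  next
    fix a b assume "a \<in> O0" "b \<in> O0"
    then obtain p q where *: "coeff p 0 = 0" "a - \<phi> p \<in> N" "coeff q 0 = 0" "b - \<phi> q \<in> N"
      unfolding O0_def by blast
    then have "(a + b) - \<phi> (p + q) \<in> N"
      using type_ideal_add[OF N *(2,4)] by (simp add: hom_add algebra_simps)
    then show "a + b \<in> O0" unfolding O0_def using * by (intro CollectI exI[of _ "p + q"]) simp
  next
    fix r a assume "a \<in> O0"
    then obtain p where p: "coeff p 0 = 0" "a - \<phi> p \<in> N" unfolding O0_def by blast
    obtain q where q: "r - \<phi> q \<in> N" using modulo_radical by blast
    have "r * a - \<phi> (q * p) = r * (a - \<phi> p) + (r - \<phi> q) * \<phi> p"
      by (simp add: hom_mult algebra_simps)
    also have "\<dots> \<in> N"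
      by (rule type_ideal_add[OF N type_ideal_mult[OF N p(2)] type_ideal_mult_right[OF N q]])
    finally show "r * a \<in> O0" unfolding O0_def using p(1)
      by (intro CollectI exI[of _ "q * p"]) (simp add: coeff_mult)
  qed
  have "N \<subseteq> O0" unfolding O0_def by (auto intro!: exI[of _ 0] simp: hom_zero)
  then have "J \<subseteq> O0" using J_subset_N by blast
  then show pre: "pre (\<pi> ` O0) = O0" by (rule quot_preimage_image[OF J O0])
  have one: "1 \<notin> O0"
  proof
    assume "1 \<in> O0"
    then obtain p where "coeff p 0 = 0" "1 - \<phi> p \<in> N" unfolding O0_def by blast
    then have "\<phi> (1 - p) \<in> N" by (simp add: hom_diff hom_one)
    then have "p = 1" using N_inj by fastforce
    then show False using \<open>coeff p 0 = 0\<close> by simp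
  qed
  note idO = quot_image_ideal[OF J O0]
  show "maximalideal (\<pi> ` O0) A"
  proof (rule maximalidealI[OF idO])
    show "carrier A \<noteq> \<pi> ` O0"
      using quot_preimage_proper_iff[OF J idO] pre one by simp
    fix Q assume Q: "ideal Q A" "\<pi> ` O0 \<subseteq> Q" "Q \<subseteq> carrier A"
    note T = quot_preimage_ideal[OF J Q(1)]
    have OT: "O0 \<subseteq> pre Q" using Q(2) by blast
    show "Q = \<pi> ` O0 \<or> Q = carrier A"
    proof (cases "pre Q \<subseteq> O0")
      case True
      then have "pre Q = O0" using OT by blast
      then show ?thesis using quot_image_preimage[OF J Q(1)] by metis
    next
      case False
      then obtain r where r: "r \<in> pre Q" "r \<notin> O0" by blast
      obtain p where p: "r - \<phi> p \<in> N" using modulo_radical by blast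
      then have c: "coeff p 0 \<noteq> 0" using r(2) unfolding O0_def by blast
      obtain c q where pq: "p = pCons c q" by (cases p)
      have "\<phi> (pCons 0 q) \<in> O0" unfolding O0_def
        by (intro CollectI exI[of _ "pCons 0 q"]) (simp add: type_ideal_zero[OF N])
      moreover have "\<phi> p \<in> pre Q"
        using p OT \<open>N \<subseteq> O0\<close> type_ideal_diff_add_cong[OF T(1)] r(1) by blast
      ultimately have "\<phi> p - \<phi> (pCons 0 q) \<in> pre Q"
        using OT type_ideal_diff[OF T(1)] by blast
      then have "\<phi> [:c:] \<in> pre Q" by (simp add: pq flip: hom_diff)
      then have "\<phi> ([:1 / c:] * [:c:]) \<in> pre Q"
        unfolding hom_mult by (rule type_ideal_mult[OF T(1)])
      moreover have "[:1 / c:] * [:c:] = 1" using c by (simp add: pq one_pCons)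
      ultimately have "1 \<in> pre Q" by (simp add: hom_one)
      then show ?thesis using quot_preimage_proper_iff[OF J Q(1)] by blast
    qed
  qed
qed

text \<open>
  All maximal ideals have height one, so the question is whether their depth is one. For the converse,
  depth one at the origin provides a nonzerodivisor \<open>y\<close> in its maximal ideal, and a power of \<open>y\<close> is a multiple of
  \<open>x\<close> modulo \<open>J\<close>; thus \<open>x\<close> is a nonzerodivisor too.
\<close>

theorem cohen_macaulay_iff:
  "cohen_macaulay A \<longleftrightarrow> (\<forall>r. \<phi> [:0, 1:] * r \<in> J \<longrightarrow> r \<in> J)"
proof
  assume "\<forall>r. \<phi> [:0, 1:] * r \<in> J \<longrightarrow> r \<in> J"
  then have x: "\<And>r. \<phi> [:0, 1:] * r \<in> J \<Longrightarrow> r \<in> J" by blast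
  show "cohen_macaulay A"
    unfolding cohen_macaulay_def
    using ideal.quotient_is_cring[OF J type_ring_cring] noetherian
      prime_height_maximal depth_maximal[OF x] by auto
next
  assume CM: "cohen_macaulay A"
  define O0 where "O0 = {r. \<exists>p. coeff p 0 = 0 \<and> r - \<phi> p \<in> N}"
  note max = origin_maximalideal[folded O0_def]
  let ?L = "{enat (length xs) | xs. regular_sequence A xs \<and> set xs \<subseteq> \<pi> ` O0}"
  have "ideal_depth A (\<pi> ` O0) = 1"
    using CM max(1) prime_height_maximal unfolding cohen_macaulay_def by auto
  then have "\<not> Sup ?L \<le> 0" by (simp add: ideal_depth_def)
  then obtain e where "e \<in> ?L" "\<not> e \<le> 0" using Sup_least[of ?L 0] by blast
  then obtain xs where xs: "xs \<noteq> []" "regular_sequence A xs" "set xs \<subseteq> \<pi> ` O0"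
    by (auto simp: zero_enat_def)
  obtain ys where ys: "xs = map \<pi> ys" by (rule quot_regular_sequence_lift[OF J xs(2)])
  then obtain y zs where y: "ys = y # zs" using xs(1) by (cases ys) auto
  have reg: "r \<in> J" if "y * r \<in> J" for r
    using xs(2) that unfolding ys quot_regular_sequence_iff[OF J] 
    by (auto simp: y Idl_type_ideal_eq[OF J] dest!: spec[of _ "0::nat"])
  have "y \<in> O0" using xs(3) max(2) by (auto simp: ys y)
  then obtain p where p: "coeff p 0 = 0" "y - \<phi> p \<in> N" unfolding O0_def by blast
  then obtain q where q: "p = [:0, 1:] * q" by (cases p) auto
  obtain m where m: "(y - \<phi> p) ^ m \<in> J" using p(2) by (auto simp: ideal_radical_def)
  show "\<forall>r. \<phi> [:0, 1:] * r \<in> J \<longrightarrow> r \<in> J"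
  proof (intro allI impI)
    fix r assume r: "\<phi> [:0, 1:] * r \<in> J"
    obtain w where "y ^ m - (y - \<phi> p) ^ m = \<phi> p * w"
      using power_diff_sumr2[of y m "y - \<phi> p"] by auto
    then have "y ^ m * r = (\<phi> [:0, 1:] * r) * (\<phi> q * w) + (y - \<phi> p) ^ m * r"
      unfolding q hom_mult by (simp add: algebra_simps)
    also have "\<dots> \<in> J"
      by (rule type_ideal_add[OF J type_ideal_mult_right[OF J r] type_ideal_mult_right[OF J m]])
    finally have "y ^ m * r \<in> J" .
    then show "r \<in> J" by (rule cancel_power_mod) (rule reg)
  qed
qed

end

section \<open>Coefficient sums over sets of exponents\<close>

text \<open>
  All ideals in question are cut out by such linear functionals: \<open>I(C)\<close> by the sets of exponents of a
  given weight, the ideal of the tangent cone by the longest exponents of a given weight.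
\<close>

definition coeff_sum :: "('i \<Rightarrow>\<^sub>0 nat) set \<Rightarrow> ('i, 'a::comm_ring_1) mpoly \<Rightarrow> 'a" where
  "coeff_sum E f = (\<Sum>u\<in>Poly_Mapping.keys f \<inter> E. Poly_Mapping.lookup f u)"

lemma coeff_sum_superset:
  assumes "finite K" "Poly_Mapping.keys f \<subseteq> K"
  shows "coeff_sum E f = (\<Sum>u\<in>K \<inter> E. Poly_Mapping.lookup f u)"
  unfolding coeff_sum_def
  by (rule sum.mono_neutral_left) (use assms in \<open>auto simp: in_keys_iff\<close>)

lemma coeff_sum_zero [simp]: "coeff_sum E 0 = 0"
  by (simp add: coeff_sum_def)

lemma coeff_sum_add: "coeff_sum E (f + g) = coeff_sum E f + coeff_sum E g"
proof -
  let ?K = "Poly_Mapping.keys f \<union> Poly_Mapping.keys g"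
  have "Poly_Mapping.keys (f + g) \<subseteq> ?K" by (rule keys_add)
  then show ?thesis
    by (simp add: coeff_sum_superset[of ?K] lookup_add sum.distrib)
qed

lemma coeff_sum_uminus: "coeff_sum E (- f) = - coeff_sum E f"
  using coeff_sum_add[of E f "- f"] by (simp add: minus_unique)

lemma coeff_sum_diff: "coeff_sum E (f - g) = coeff_sum E f - coeff_sum E g"
  using coeff_sum_add[of E f "- g"] by (simp add: coeff_sum_uminus)

lemma coeff_sum_single [simp]:
  "coeff_sum E (Poly_Mapping.single u c) = (if u \<in> E then c else 0)"
  by (auto simp: coeff_sum_superset[of "{u}"])

lemma coeff_sum_empty [simp]: "coeff_sum {} f = 0"
  by (simp add: coeff_sum_def)

lemma mpoly_sum_monomials:
  "f = (\<Sum>u\<in>Poly_Mapping.keys f. Poly_Mapping.single u (Poly_Mapping.lookup f u))"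
  by (rule poly_mapping_eqI) (auto simp: lookup_sum lookup_single when_def in_keys_iff)

lemma mpoly_induct [case_names single add]:
  assumes "\<And>u c. P (Poly_Mapping.single u c)" "\<And>f g. P f \<Longrightarrow> P g \<Longrightarrow> P (f + g)"
  shows "P (f :: ('i, 'a::comm_ring_1) mpoly)"
proof -
  have "P (\<Sum>u\<in>K. Poly_Mapping.single u (Poly_Mapping.lookup f u))" if "finite K" for K
    using that
  proof induction
    case empty
    then show ?case using assms(1)[of undefined 0] by simp
  qed (simp add: assms)
  from this[of "Poly_Mapping.keys f"] show ?thesis by (simp flip: mpoly_sum_monomials)
qed

text \<open>Multiplication by a monomial translates the set of exponents; everything below rests on this.\<close>

lemma coeff_sum_single_mult:
  "coeff_sum E (Poly_Mapping.single v c * f) = c * coeff_sum {u. v + u \<in> E} f"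
  by (induction f rule: mpoly_induct) (auto simp: mult_single coeff_sum_add algebra_simps)

lemma coeff_sum_mult_eq_0:
  assumes "\<And>v. coeff_sum {u. v + u \<in> E} f = 0"
  shows "coeff_sum E (g * f) = 0"
  by (induction g rule: mpoly_induct)
    (simp_all add: coeff_sum_single_mult assms coeff_sum_add distrib_right)

lemma coeff_sum_Idl_eq_0:
  assumes f: "f \<in> Idl\<^bsub>mpoly_ring\<^esub> F" and F: "\<And>b v. b \<in> F \<Longrightarrow> coeff_sum {u. v + u \<in> E} b = 0"
  shows "coeff_sum E f = 0"
proof -
  let ?T = "{f. \<forall>g. coeff_sum E (g * f) = 0}"
  have "type_ideal ?T"
    by (rule type_idealI) (auto simp: distrib_left coeff_sum_add simp flip: mult.assoc)
  then have "Idl\<^bsub>mpoly_ring\<^esub> F \<subseteq> ?T"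
    by (rule Idl_type_minimal) (auto intro: coeff_sum_mult_eq_0 F)
  then have "coeff_sum E (1 * f) = 0" using f by blast
  then show ?thesis by simp
qed

lemma monomial_mult: "monomial u * monomial v = monomial (u + v)"
  by (simp add: monomial_def mult_single)

lemma Var_power: "Var i ^ k = monomial (Poly_Mapping.single i k)"
proof (induction k)
  case (Suc k)
  have "Poly_Mapping.single i (Suc k) = Poly_Mapping.single i 1 + Poly_Mapping.single i k"
    by (simp flip: single_add)
  then show ?case using Suc by (simp add: Var_def monomial_mult)
qed (simp add: monomial_def)

section \<open>Weights\<close>

definition weight :: "('i::finite \<Rightarrow> nat) \<Rightarrow> ('i \<Rightarrow>\<^sub>0 nat) \<Rightarrow> nat" where
  "weight n u = (\<Sum>i\<in>UNIV. Poly_Mapping.lookup u i * n i)"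

lemma weight_zero [simp]: "weight n 0 = 0"
  by (simp add: weight_def)

lemma weight_add: "weight n (u + v) = weight n u + weight n v"
  by (simp add: weight_def lookup_add algebra_simps sum.distrib)

lemma sum_lookup_single:
  "(\<Sum>j\<in>(UNIV::'i::finite set). Poly_Mapping.lookup (Poly_Mapping.single i (k::nat)) j * m j) = k * m i"
proof -
  have "(\<Sum>j\<in>UNIV. Poly_Mapping.lookup (Poly_Mapping.single i k) j * m j) = (\<Sum>j\<in>UNIV. if j = i then k * m i else 0)"
    by (rule sum.cong) (auto simp: lookup_single when_def)
  then show ?thesis by simp
qed

lemma weight_single [simp]: "weight n (Poly_Mapping.single i k) = k * n i"
  by (simp add: weight_def sum_lookup_single)

lemma mon_deg_weight: "mon_deg u = weight (\<lambda>_. 1) u"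
  by (simp add: mon_deg_def weight_def)

lemma mon_deg_simps [simp]:
  "mon_deg 0 = 0" "mon_deg (u + v) = mon_deg u + mon_deg v" "mon_deg (Poly_Mapping.single i k) = k"
  by (simp_all add: mon_deg_weight weight_add)

lemma mon_deg_le_weight:
  assumes "\<And>i. m \<le> n i"
  shows "m * mon_deg u \<le> weight n u"
  unfolding mon_deg_def weight_def sum_distrib_left
  by (rule sum_mono) (use assms in \<open>simp add: mult.commute\<close>)

lemma coeff_curve_hom:
  "Polynomial.coeff (curve_hom n f) s = coeff_sum {u. weight n u = s} (f :: ('i::finite, 'a::field) mpoly)"
proof -
  have prod: "(\<Prod>i\<in>S. (Polynomial.monom 1 (n i) :: 'a poly) ^ Poly_Mapping.lookup u i)
      = Polynomial.monom 1 (\<Sum>i\<in>S. Poly_Mapping.lookup u i * n i)" for u and S :: "'i set"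
    by (induction S rule: infinite_finite_induct)
      (simp_all add: monom_power mult_monom mult.commute monom_0 one_pCons)
  have "curve_hom n f =
      (\<Sum>u\<in>Poly_Mapping.keys f. Polynomial.monom (Poly_Mapping.lookup f u) (weight n u))"
    unfolding curve_hom_def prod by (simp add: smult_monom weight_def)
  then show ?thesis
    by (simp add: coeff_sum coeff_sum_def sum.If_cases[symmetric] sum.inter_filter[symmetric] Int_def
      del: monom_eq_0_iff)
qed

lemma curve_ideal_iff:
  "f \<in> curve_ideal n \<longleftrightarrow> (\<forall>s. coeff_sum {u. weight n u = s} f = 0)"
  unfolding curve_ideal_def by (simp add: poly_eq_iff coeff_curve_hom)

lemma monomial_diff_in_curve_ideal_iff:
  "(monomial u - monomial v :: ('i::finite, 'a::field) mpoly) \<in> curve_ideal n \<longleftrightarrow> weight n u = weight n v"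
  unfolding curve_ideal_iff monomial_def by (auto simp: coeff_sum_diff split: if_splits)

section \<open>The ideal of the tangent cone\<close>

lemma lookup_hom_part:
  "Poly_Mapping.lookup (hom_part d f) u = (if mon_deg u = d then Poly_Mapping.lookup f u else 0)"
  unfolding hom_part_def by (auto simp: lookup_sum lookup_single when_def in_keys_iff)

lemma hom_part_zero [simp]: "hom_part d 0 = 0"
  by (rule poly_mapping_eqI) (simp add: lookup_hom_part)

lemma coeff_sum_hom_part: "coeff_sum E (hom_part d f) = coeff_sum (E \<inter> {u. mon_deg u = d}) f"
proof -
  have "coeff_sum E (hom_part d f) =
      (\<Sum>u\<in>Poly_Mapping.keys f \<inter> E. Poly_Mapping.lookup (hom_part d f) u)"
    by (rule coeff_sum_superset) (auto simp: in_keys_iff lookup_hom_part split: if_splits)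
  also have "\<dots> = coeff_sum (E \<inter> {u. mon_deg u = d}) f"
    unfolding coeff_sum_def lookup_hom_part
    by (simp add: sum.inter_restrict[symmetric] Int_assoc flip: sum.inter_filter) 
      (simp add: Int_def conj_ac)
  finally show ?thesis .
qed

lemma initial_form_eq:
  assumes "\<And>u. u \<in> Poly_Mapping.keys f \<Longrightarrow> d \<le> mon_deg u"
    and "v \<in> Poly_Mapping.keys f" "mon_deg v = d"
  shows "initial_form f = hom_part d f"
proof -
  have "(LEAST d. hom_part d f \<noteq> 0) = d"
  proof (rule Least_equality)
    show "hom_part d f \<noteq> 0"
      using assms(2,3) by (metis in_keys_iff lookup_hom_part lookup_zero)
    fix e assume "hom_part e f \<noteq> 0"
    then obtain u where "Poly_Mapping.lookup (hom_part e f) u \<noteq> 0"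
      by (metis lookup_zero poly_mapping_eqI)
    then show "d \<le> e" using assms(1)[of u] by (auto simp: lookup_hom_part in_keys_iff split: if_splits)
  qed
  then show ?thesis by (simp add: initial_form_def)
qed

lemma initial_form_cases:
  fixes f :: "('i::finite, 'a::comm_ring_1) mpoly"
  assumes "f \<noteq> 0"
  obtains d where "initial_form f = hom_part d f" "\<And>u. u \<in> Poly_Mapping.keys f \<Longrightarrow> d \<le> mon_deg u"
proof -
  obtain v0 where "v0 \<in> Poly_Mapping.keys f"
    using assms by (metis poly_mapping_eqI lookup_zero in_keys_iff)
  then obtain v where v: "v \<in> Poly_Mapping.keys f" "\<And>u. u \<in> Poly_Mapping.keys f \<Longrightarrow> mon_deg v \<le> mon_deg u"
    using ex_has_least_nat[of "\<lambda>u. u \<in> Poly_Mapping.keys f" v0 mon_deg] by blast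
  then show ?thesis using that[OF initial_form_eq[of f "mon_deg v" v]] by blast
qed

text \<open>
  A longest exponent vector realises the order of its weight in the semigroup, that is, the largest
  power of the maximal ideal of \<open>K[C]\<close> at the origin that contains the corresponding power of \<open>t\<close>.
\<close>

definition longest :: "('i::finite \<Rightarrow> nat) \<Rightarrow> ('i \<Rightarrow>\<^sub>0 nat) \<Rightarrow> bool" where
  "longest n u \<longleftrightarrow> (\<forall>v. weight n v = weight n u \<longrightarrow> mon_deg v \<le> mon_deg u)"

abbreviation longest_exps :: "('i::finite \<Rightarrow> nat) \<Rightarrow> nat \<Rightarrow> ('i \<Rightarrow>\<^sub>0 nat) set" where
  "longest_exps n s \<equiv> {u. weight n u = s \<and> longest n u}"

text \<open>The linear description of \<open>I(C)\<^sub>*\<close>; the equality is \<open>initial_ideal_eq\<close> below.\<close>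

definition tangent_ideal :: "('i::finite \<Rightarrow> nat) \<Rightarrow> ('i, 'a::comm_ring_1) mpoly set" where
  "tangent_ideal n = {g. \<forall>s. coeff_sum (longest_exps n s) g = 0}"

lemma longest_mon_deg_eq:
  "longest n u \<Longrightarrow> longest n v \<Longrightarrow> weight n u = weight n v \<Longrightarrow> mon_deg u = mon_deg v"
  unfolding longest_def by (simp add: antisym)

lemma longest_mon_deg_ge:
  "longest n u \<Longrightarrow> weight n v = weight n u \<Longrightarrow> mon_deg u \<le> mon_deg v \<Longrightarrow> longest n v"
  unfolding longest_def by (metis order_trans)

lemma longest_summand:
  assumes "longest n (v + u)"
  shows "longest n u"
  unfolding longest_def
proof (intro allI impI)
  fix w assume "weight n w = weight n u"
  then have "mon_deg (v + w) \<le> mon_deg (v + u)"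
    using assms unfolding longest_def by (metis weight_add)
  then show "mon_deg w \<le> mon_deg u" by simp
qed

text \<open>
  If one translate by \<open>v\<close> of a vector of a given weight is longest, then exactly the translates of
  the longest vectors of this weight are. Multiplication by a monomial thus either preserves one
  functional or annihilates it.
\<close>

lemma shift_longest_exps:
  assumes "longest n (v + w)"
  shows "{u. v + u \<in> longest_exps n (weight n (v + w))} = longest_exps n (weight n w)"
proof -
  have "longest n (v + u)" if "weight n u = weight n w" "longest n u" for u
  proof (rule longest_mon_deg_ge[OF assms])
    show "mon_deg (v + w) \<le> mon_deg (v + u)"
      using longest_mon_deg_eq[OF that(2) longest_summand[OF assms] that(1)] by simp
  qed (simp add: weight_add that)
  then show ?thesis using longest_summand by (auto simp: weight_add)
qed

lemma shift_longest_exps_cases: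
  obtains "{u. v + u \<in> longest_exps n s} = {}"
  | t where "weight n v + t = s" "{u. v + u \<in> longest_exps n s} = longest_exps n t"
proof (cases "{u. v + u \<in> longest_exps n s} = {}")
  case False
  then obtain w where "longest n (v + w)" "weight n (v + w) = s" by auto
  then show ?thesis using that(2)[of "weight n w"] shift_longest_exps[of n v w] by (simp add: weight_add)
qed (use that in blast)

lemma coeff_sum_longest_mult_eq_0:
  assumes "\<And>t. t \<le> s \<Longrightarrow> coeff_sum (longest_exps n t) g = 0"
  shows "coeff_sum (longest_exps n s) (r * g) = 0"
proof (rule coeff_sum_mult_eq_0)
  fix v show "coeff_sum {u. v + u \<in> longest_exps n s} g = 0"
    by (rule shift_longest_exps_cases[of v n s]) (use assms in \<open>auto simp del: mem_Collect_eq\<close>)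
qed

lemma tangent_ideal_ideal: "type_ideal (tangent_ideal n)"
  by (rule type_idealI)
    (auto simp: tangent_ideal_def coeff_sum_add intro!: coeff_sum_longest_mult_eq_0)

lemma single_in_tangent_ideal: "\<not> longest n u \<Longrightarrow> Poly_Mapping.single u c \<in> tangent_ideal n"
  by (simp add: tangent_ideal_def)

text \<open>
  If a longest exponent of weight \<open>s\<close> has degree \<open>d\<close>, the lowest degree in \<open>f\<close>, then all exponents of
  weight \<open>s\<close> in \<open>f\<close> have degree exactly \<open>d\<close>, and their coefficients cancel since \<open>f\<close> vanishes on the
  curve.
\<close>

lemma initial_form_in_tangent_ideal:
  assumes "f \<in> curve_ideal n"
  shows "initial_form f \<in> tangent_ideal n"
proof (cases "f = 0")
  case True
  then show ?thesis using type_ideal_zero[OF tangent_ideal_ideal] by (simp add: initial_form_def)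
next
  case False
  then obtain d where d: "initial_form f = hom_part d f"
    "\<And>u. u \<in> Poly_Mapping.keys f \<Longrightarrow> d \<le> mon_deg u"
    by (rule initial_form_cases) blast
  have "coeff_sum (longest_exps n s \<inter> {u. mon_deg u = d}) f = 0" for s
  proof (cases "longest_exps n s \<inter> {u. mon_deg u = d} = {}")
    case False
    then obtain w where w: "longest n w" "weight n w = s" "mon_deg w = d" by auto
    have "u \<in> longest_exps n s \<inter> {u. mon_deg u = d} \<longleftrightarrow> weight n u = s"
      if "u \<in> Poly_Mapping.keys f" for u
      using d(2)[OF that] w longest_mon_deg_ge[OF w(1), of u] unfolding longest_def
      by (auto intro: antisym)
    then have "coeff_sum (longest_exps n s \<inter> {u. mon_deg u = d}) f = coeff_sum {u. weight n u = s} f"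
      unfolding coeff_sum_def by (intro sum.cong) auto
    then show ?thesis using assms by (simp add: curve_ideal_iff)
  qed simp
  then show ?thesis by (simp add: tangent_ideal_def d(1) coeff_sum_hom_part)
qed

section \<open>The line in the tangent cone\<close>

definition line_hom :: "'i \<Rightarrow> 'a::comm_ring_1 poly \<Rightarrow> ('i, 'a) mpoly" where
  "line_hom i p = poly (map_poly (Poly_Mapping.single 0) p) (Var i)"

lemma line_hom_0 [simp]: "line_hom i 0 = 0"
  by (simp add: line_hom_def)

lemma line_hom_pCons [simp]: "line_hom i (pCons a p) = Poly_Mapping.single 0 a + Var i * line_hom i p"
  by (cases "a = 0 \<and> p = 0") (auto simp: line_hom_def map_poly_pCons)

lemma line_hom_add: "line_hom i (p + q) = line_hom i p + line_hom i q"
  by (induction p q rule: poly_induct2) (simp_all add: single_add algebra_simps)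

lemma line_hom_smult: "line_hom i (smult a p) = Poly_Mapping.single 0 a * line_hom i p"
  by (induction p) (simp_all add: mult_single algebra_simps)

lemma line_hom_mult: "line_hom i (p * q) = line_hom i p * line_hom i q"
  by (induction p) (simp_all add: line_hom_add line_hom_smult algebra_simps)

lemma line_hom_monom:
  "line_hom i (Polynomial.monom c k) = Poly_Mapping.single (Poly_Mapping.single i k) c"
  by (induction k) (simp_all add: monom_0 monom_Suc Var_def monomial_def mult_single flip: single_add)

lemma finite_bounded_exponents: "finite {u :: 'i::finite \<Rightarrow>\<^sub>0 nat. \<forall>i. Poly_Mapping.lookup u i < m}"
proof (rule finite_imageD)
  show "finite (Poly_Mapping.lookup ` {u :: 'i \<Rightarrow>\<^sub>0 nat. \<forall>i. Poly_Mapping.lookup u i < m})"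
    by (rule finite_subset[of _ "PiE UNIV (\<lambda>_. {..<m})"]) (auto intro: finite_PiE)
  show "inj_on Poly_Mapping.lookup {u :: 'i \<Rightarrow>\<^sub>0 nat. \<forall>i. Poly_Mapping.lookup u i < m}"
    by (auto intro: inj_onI poly_mapping_eqI)
qed

lemma exponent_split:
  fixes u :: "'i \<Rightarrow>\<^sub>0 nat"
  assumes "k \<le> Poly_Mapping.lookup u i"
  obtains v where "u = Poly_Mapping.single i k + v"
    "\<And>j. Poly_Mapping.lookup v j = (if j = i then Poly_Mapping.lookup u i - k else Poly_Mapping.lookup u j)"
proof
  show "u = Poly_Mapping.single i k + (u - Poly_Mapping.single i k)"
    by (rule poly_mapping_eqI) (use assms in \<open>auto simp: lookup_add lookup_minus lookup_single when_def\<close>)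
qed (auto simp: lookup_minus lookup_single when_def)

text \<open>In the comments, \<open>x\<^sub>0\<close> and \<open>n\<^sub>0\<close> stand for \<open>Var i0\<close> and \<open>n i0\<close>.\<close>

locale curve_with_least_generator =
  fixes n :: "'i::finite \<Rightarrow> nat" and i0 :: 'i
  assumes pos: "0 < n i0" and least: "\<And>i. i \<noteq> i0 \<Longrightarrow> n i0 < n i"
begin

lemma generators_ge: "n i0 \<le> n i"
  using least[of i] by (cases "i = i0") auto

lemma mon_deg_bound: "n i0 * mon_deg u \<le> weight n u"
  by (rule mon_deg_le_weight) (rule generators_ge)

lemma longest_exists: "\<exists>v. longest n v \<and> weight n v = weight n u \<and> mon_deg u \<le> mon_deg v"
proof -
  let ?P = "\<lambda>v. weight n v = weight n u \<and> mon_deg u \<le> mon_deg v"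
  have "mon_deg v \<le> weight n u" if "?P v" for v
    using mon_deg_bound[of v] that pos by (metis le_trans mult_le_mono1 nat_mult_1 Suc_leI One_nat_def)
  then have "\<exists>v. ?P v \<and> (\<forall>w. ?P w \<longrightarrow> mon_deg w \<le> mon_deg v)"
    by (intro ex_has_greatest_nat[of ?P u mon_deg "Suc (weight n u)"]) (auto simp: less_Suc_eq_le)
  then show ?thesis unfolding longest_def by (metis le_trans nat_le_linear)
qed

lemma longest_power: "longest n (Poly_Mapping.single i0 k)"
  unfolding longest_def using mon_deg_bound pos by (simp add: mult.commute) (metis mult_le_cancel2)

text \<open>The monomial \<open>x\<^sub>i^n\<^sub>0\<close> has the same weight as \<open>x\<^sub>0^n\<^sub>i\<close> but is shorter, \<open>n\<^sub>0\<close> being least.\<close>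

lemma not_longest_power: "i \<noteq> i0 \<Longrightarrow> n i0 \<le> k \<Longrightarrow> \<not> longest n (Poly_Mapping.single i k)"
proof
  assume i: "i \<noteq> i0" and k: "n i0 \<le> k" and l: "longest n (Poly_Mapping.single i k)"
  let ?v = "Poly_Mapping.single i0 (n i) + Poly_Mapping.single i (k - n i0)"
  have "weight n ?v = weight n (Poly_Mapping.single i k)"
    using k by (simp add: weight_add algebra_simps flip: add_mult_distrib add_mult_distrib2)
  then have "mon_deg ?v \<le> k" using l unfolding longest_def by force
  then show False using least[OF i] k by simp
qed

text \<open>
  For the inclusion of the linear description in the initial ideal, every monomial is congruent,
  modulo an initial form of a binomial, to one chosen longest monomial \<open>\<beta> s\<close> of its weight \<open>s\<close>, or to
  \<open>0\<close> if it is not longest. After this reduction the coefficient of \<open>\<beta> s\<close> is the coefficient sum over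
  the longest exponents of weight \<open>s\<close>.
\<close>

theorem initial_ideal_eq: "initial_ideal (curve_ideal n :: ('i, 'a::field) mpoly set) = tangent_ideal n"
proof
  let ?I = "curve_ideal n :: ('i, 'a) mpoly set"
  note id = Idl_type_ideal[of "initial_form ` ?I"]
  show "initial_ideal ?I \<subseteq> tangent_ideal n"
    unfolding initial_ideal_def
    by (rule Idl_type_minimal[OF tangent_ideal_ideal]) (auto intro: initial_form_in_tangent_ideal)
  have init: "initial_form f \<in> initial_ideal ?I" if "f \<in> ?I" for f
    using that Idl_type_superset[of "initial_form ` ?I"] unfolding initial_ideal_def by blast
  define \<beta> where "\<beta> s = (SOME v. longest n v \<and> weight n v = s)" for s
  have \<beta>: "longest n (\<beta> (weight n u))" "weight n (\<beta> (weight n u)) = weight n u" for u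
    using someI_ex[of "\<lambda>v. longest n v \<and> weight n v = weight n u"] longest_exists[of u]
    unfolding \<beta>_def by blast+
  define rep :: "('i \<Rightarrow>\<^sub>0 nat) \<Rightarrow> ('i, 'a) mpoly"
    where "rep u = (if longest n u then monomial (\<beta> (weight n u)) else 0)" for u
  have mono: "monomial u - rep u \<in> initial_ideal ?I" for u
  proof (cases "u = \<beta> (weight n u)")
    case True
    then have "rep u = monomial u" using \<beta>(1)[of u] by (simp add: rep_def)
    then show ?thesis using type_ideal_zero[OF id] by (simp add: initial_ideal_def)
  next
    case False
    let ?v = "\<beta> (weight n u)" and ?f = "monomial u - monomial (\<beta> (weight n u)) :: ('i, 'a) mpoly"
    have keys: "Poly_Mapping.keys ?f = {u, ?v}"
      using False by (auto simp: monomial_def in_keys_iff lookup_minus lookup_single when_def split: if_splits)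
    have deg: "mon_deg u \<le> mon_deg ?v" using \<beta>[of u] unfolding longest_def by simp
    have "initial_form ?f = hom_part (mon_deg u) ?f"
      by (rule initial_form_eq[of _ _ u]) (use deg in \<open>auto simp: keys\<close>)
    also have "\<dots> = monomial u - rep u"
    proof (cases "longest n u")
      case True
      then have "mon_deg u = mon_deg ?v" using longest_mon_deg_eq \<beta> by metis
      then show ?thesis using True
        by (intro poly_mapping_eqI) (auto simp: lookup_hom_part rep_def monomial_def lookup_minus lookup_single when_def)
    next
      case False
      then have "mon_deg u \<noteq> mon_deg ?v" using longest_mon_deg_ge[OF \<beta>(1)[of u], of u] \<beta>(2)[of u] False by auto
      then show ?thesis using False
        by (intro poly_mapping_eqI) (auto simp: lookup_hom_part rep_def monomial_def lookup_minus lookup_single when_def)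
    qed
    finally show ?thesis
      using init[of ?f] by (simp add: monomial_diff_in_curve_ideal_iff \<beta>(2))
  qed
  show "tangent_ideal n \<subseteq> initial_ideal ?I"
  proof
    fix g :: "('i, 'a) mpoly" assume g: "g \<in> tangent_ideal n"
    let ?K = "Poly_Mapping.keys g" and ?c = "\<lambda>u. Poly_Mapping.single 0 (Poly_Mapping.lookup g u) :: ('i, 'a) mpoly"
    have "(\<Sum>u\<in>?K. ?c u * rep u) = (\<Sum>s\<in>weight n ` ?K. \<Sum>u\<in>{u\<in>?K. weight n u = s}. ?c u * rep u)"
      by (rule sum.group[symmetric]) auto
    also have "\<dots> = (\<Sum>s\<in>weight n ` ?K. Poly_Mapping.single (\<beta> s) (coeff_sum (longest_exps n s) g))"
    proof (rule sum.cong[OF refl])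
      fix s
      have "(\<Sum>u\<in>{u\<in>?K. weight n u = s}. ?c u * rep u)
          = (\<Sum>u\<in>{u\<in>?K. weight n u = s}. if longest n u then Poly_Mapping.single (\<beta> s) (Poly_Mapping.lookup g u) else 0)"
        by (rule sum.cong) (auto simp: rep_def monomial_def mult_single)
      also have "\<dots> = (\<Sum>u\<in>?K \<inter> longest_exps n s. Poly_Mapping.single (\<beta> s) (Poly_Mapping.lookup g u))"
        by (simp add: sum.inter_filter[symmetric]) (rule sum.cong, auto)
      also have "\<dots> = Poly_Mapping.single (\<beta> s) (coeff_sum (longest_exps n s) g)"
        unfolding coeff_sum_def
        by (rule poly_mapping_eqI) (simp add: lookup_sum lookup_single when_def)
      finally show "(\<Sum>u\<in>{u\<in>?K. weight n u = s}. ?c u * rep u)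
          = Poly_Mapping.single (\<beta> s) (coeff_sum (longest_exps n s) g)" .
    qed
    also have "\<dots> = 0" using g by (simp add: tangent_ideal_def)
    finally have "(\<Sum>u\<in>?K. ?c u * rep u) = 0" .
    moreover have "g = (\<Sum>u\<in>?K. ?c u * monomial u)"
      by (subst mpoly_sum_monomials) (simp add: monomial_def mult_single)
    ultimately have "g = (\<Sum>u\<in>?K. ?c u * (monomial u - rep u))"
      by (simp add: right_diff_distrib sum_subtractf)
    moreover have "(\<Sum>u\<in>?K. ?c u * (monomial u - rep u)) \<in> initial_ideal ?I"
      using mono unfolding initial_ideal_def
      by (intro type_ideal_sum[OF id] type_ideal_mult[OF id])
    ultimately show "g \<in> initial_ideal ?I" by simp
  qed
qed

text \<open>The power \<open>x\<^sub>0^k\<close> is longest, so the functionals recover the coefficients: \<open>K[X]\<close> embeds.\<close>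

lemma coeff_sum_line_hom:
  "coeff_sum (longest_exps n (k * n i0)) (line_hom i0 p) = Polynomial.coeff p k"
proof (induction p arbitrary: k)
  case (pCons a p)
  let ?E = "longest_exps n (k * n i0)" and ?e = "Poly_Mapping.single i0 1 :: 'i \<Rightarrow>\<^sub>0 nat"
  have zero: "0 \<in> ?E \<longleftrightarrow> k = 0" using longest_power[of 0] pos by auto
  have "coeff_sum {u. ?e + u \<in> ?E} (line_hom i0 p) = (case k of 0 \<Rightarrow> 0 | Suc j \<Rightarrow> Polynomial.coeff p j)"
  proof (cases k)
    case 0
    have "weight n (?e + u) \<noteq> 0" for u using pos by (simp add: weight_add)
    then have "{u. ?e + u \<in> ?E} = {}" using 0 by auto
    then have "coeff_sum {u. ?e + u \<in> ?E} (line_hom i0 p) = 0" by (simp only: coeff_sum_empty)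
    then show ?thesis using 0 by simp
  next
    case (Suc j)
    have split: "?e + Poly_Mapping.single i0 j = Poly_Mapping.single i0 k"
      by (simp add: Suc flip: single_add)
    have "{u. ?e + u \<in> ?E} = longest_exps n (j * n i0)"
      using shift_longest_exps[of n ?e "Poly_Mapping.single i0 j"] longest_power[of k]
      unfolding split weight_single by blast
    then have "coeff_sum {u. ?e + u \<in> ?E} (line_hom i0 p) = Polynomial.coeff p j"
      by (simp only: pCons.IH)
    then show ?thesis using Suc by simp
  qed
  then show ?case
    unfolding line_hom_pCons Var_def monomial_def coeff_sum_add coeff_sum_single_mult coeff_sum_single zero
    by (cases k) auto
qed simp

lemma Var_nilpotent:
  assumes "i \<noteq> i0"
  shows "Var i \<in> ideal_radical (tangent_ideal n :: ('i, 'a::comm_ring_1) mpoly set)"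
proof -
  have "(Var i ^ n i0 :: ('i, 'a) mpoly) \<in> tangent_ideal n"
    unfolding Var_power monomial_def
    by (rule single_in_tangent_ideal[OF not_longest_power[OF assms order_refl]])
  then show ?thesis unfolding ideal_radical_def by blast
qed

text \<open>
  A polynomial in \<open>x\<^sub>0\<close> with nonzero constant term is a nonzerodivisor by induction on the weight: the
  higher terms only involve functionals of smaller weight. Monomials with an exponent at least
  \<open>n\<^sub>0\<close> away from \<open>x\<^sub>0\<close> vanish, so finitely many monomials generate the quotient over \<open>K[x\<^sub>0]\<close>.
\<close>

lemma thickened_line_tangent_ideal:
  "thickened_line (tangent_ideal n :: ('i, 'a::field) mpoly set) (line_hom i0)"
proof (rule thickened_line.intro)
  let ?J = "tangent_ideal n :: ('i, 'a) mpoly set" and ?\<phi> = "line_hom i0 :: 'a poly \<Rightarrow> _"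
  note J = tangent_ideal_ideal[of n] and N = ideal_radical_ideal[OF tangent_ideal_ideal[of n]]
  show "type_ideal ?J" by (rule J)
  show "?\<phi> (p + q) = ?\<phi> p + ?\<phi> q" "?\<phi> (p * q) = ?\<phi> p * ?\<phi> q" for p q
    by (rule line_hom_add line_hom_mult)+
  show "?\<phi> 1 = 1" by (simp add: one_pCons)
  show "p = 0" if "?\<phi> p \<in> ?J" for p
  proof (rule poly_eqI)
    fix k show "Polynomial.coeff p k = Polynomial.coeff 0 k"
      using that coeff_sum_line_hom[of k p] by (simp add: tangent_ideal_def)
  qed
  show "\<exists>p. r - ?\<phi> p \<in> ideal_radical ?J" for r
  proof (induction r rule: mpoly_induct)
    case (single u c)
    show ?case
    proof (cases "\<exists>i. i \<noteq> i0 \<and> Poly_Mapping.lookup u i \<noteq> 0")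
      case True
      then obtain i where i: "i \<noteq> i0" "1 \<le> Poly_Mapping.lookup u i" by auto
      from exponent_split[OF i(2)] obtain v where "u = Poly_Mapping.single i 1 + v" by metis
      then have "Poly_Mapping.single u c = Var i * Poly_Mapping.single v c"
        by (simp add: Var_def monomial_def mult_single)
      then show ?thesis
        using type_ideal_mult_right[OF N Var_nilpotent[OF i(1)]] by (intro exI[of _ 0]) simp
    next
      case False
      then have "u = Poly_Mapping.single i0 (Poly_Mapping.lookup u i0)"
        by (intro poly_mapping_eqI) (auto simp: lookup_single when_def)
      then have "Poly_Mapping.single u c - ?\<phi> (Polynomial.monom c (Poly_Mapping.lookup u i0)) = 0"
        by (simp add: line_hom_monom)
      then show ?thesis using type_ideal_zero[OF N] by metis
    qed
  next
    case (add f g)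
    then obtain p q where "f - ?\<phi> p \<in> ideal_radical ?J" "g - ?\<phi> q \<in> ideal_radical ?J" by blast
    then have "(f + g) - ?\<phi> (p + q) \<in> ideal_radical ?J"
      using type_ideal_add[OF N, of "f - ?\<phi> p" "g - ?\<phi> q"] by (simp add: line_hom_add algebra_simps)
    then show ?case by blast
  qed
  show "r \<in> ?J" if c: "Polynomial.coeff p 0 \<noteq> 0" and r: "?\<phi> p * r \<in> ?J" for p r
  proof -
    obtain a q where p: "p = pCons a q" by (cases p)
    have "coeff_sum (longest_exps n s) r = 0" for s
    proof (induction s rule: less_induct)
      case (less s)
      let ?e = "Poly_Mapping.single i0 1 :: 'i \<Rightarrow>\<^sub>0 nat"
      have "coeff_sum {u. ?e + u \<in> longest_exps n s} (?\<phi> q * r) = 0"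
      proof (rule shift_longest_exps_cases[of ?e n s])
        fix t assume "weight n ?e + t = s" "{u. ?e + u \<in> longest_exps n s} = longest_exps n t"
        then show ?thesis
          using less pos coeff_sum_longest_mult_eq_0[of t n r "?\<phi> q"] by simp
      qed (simp only: coeff_sum_empty)
      moreover have "?\<phi> p * r = Poly_Mapping.single 0 a * r + Poly_Mapping.single ?e 1 * (?\<phi> q * r)"
        by (simp add: p Var_def monomial_def algebra_simps)
      moreover have "coeff_sum (longest_exps n s) (?\<phi> p * r) = 0"
        using r unfolding tangent_ideal_def by blast
      ultimately have "a * coeff_sum (longest_exps n s) r = 0"
        by (simp add: coeff_sum_add coeff_sum_single_mult)
      then show ?case using c p by simp
    qed
    then show ?thesis by (simp add: tangent_ideal_def)
  qed
  define M where "M = {u :: 'i \<Rightarrow>\<^sub>0 nat. \<forall>i. Poly_Mapping.lookup u i < n i0}"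
  define B where "B = (monomial ` M :: ('i, 'a) mpoly set)"
  have "\<exists>c. r - (\<Sum>b\<in>B. ?\<phi> (c b) * b) \<in> ?J" for r
  proof (induction r rule: mpoly_induct)
    case (single u c)
    show ?case
    proof (cases "\<exists>i. i \<noteq> i0 \<and> n i0 \<le> Poly_Mapping.lookup u i")
      case True
      then obtain i where i: "i \<noteq> i0" "n i0 \<le> Poly_Mapping.lookup u i" by auto
      from exponent_split[OF i(2)] obtain v where "u = Poly_Mapping.single i (n i0) + v" by metis
      then have "\<not> longest n u"
        using not_longest_power[OF i(1) order_refl] longest_summand[of n v "Poly_Mapping.single i (n i0)"]
        by (metis add.commute)
      then have "Poly_Mapping.single u c \<in> ?J" by (rule single_in_tangent_ideal)
      then show ?thesis by (intro exI[of _ "\<lambda>_. 0"]) simp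
    next
      case False
      from exponent_split[OF order_refl, of u i0] obtain v
        where u: "u = Poly_Mapping.single i0 (Poly_Mapping.lookup u i0) + v"
          and v: "\<And>j. Poly_Mapping.lookup v j = (if j = i0 then 0 else Poly_Mapping.lookup u j)"
        by (metis diff_self_eq_0)
      have "v \<in> M" unfolding M_def using False pos by (auto simp: v not_le)
      then have mem: "monomial v \<in> B" by (auto simp: B_def)
      let ?p = "Polynomial.monom c (Poly_Mapping.lookup u i0)"
      have fin: "finite B" unfolding B_def M_def by (intro finite_imageI finite_bounded_exponents)
      have "(\<Sum>b\<in>B. ?\<phi> (if b = monomial v then ?p else 0) * b)
          = (\<Sum>b\<in>B. if b = monomial v then ?\<phi> ?p * monomial v else 0)"
        by (rule sum.cong) auto
      also have "\<dots> = ?\<phi> ?p * monomial v" using fin mem by simp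
      also have "\<dots> = Poly_Mapping.single u c"
        by (subst (2) u) (simp add: line_hom_monom monomial_def mult_single)
      finally show ?thesis using type_ideal_zero[OF J]
        by (intro exI[of _ "\<lambda>b. if b = monomial v then ?p else 0"]) simp
    qed
  next
    case (add f g)
    then obtain c d where "f - (\<Sum>b\<in>B. ?\<phi> (c b) * b) \<in> ?J" "g - (\<Sum>b\<in>B. ?\<phi> (d b) * b) \<in> ?J" by blast
    from type_ideal_add[OF J this] have "f + g - (\<Sum>b\<in>B. ?\<phi> (c b + d b) * b) \<in> ?J"
      by (simp add: line_hom_add distrib_right sum.distrib algebra_simps)
    then show ?case by (intro exI[of _ "\<lambda>b. c b + d b"])
  qed
  moreover have "finite B" unfolding B_def M_def by (intro finite_imageI finite_bounded_exponents)
  ultimately show "\<exists>B. finite B \<and> (\<forall>r. \<exists>c. r - (\<Sum>b\<in>B. ?\<phi> (c b) * b) \<in> ?J)"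
    by blast
qed

lemma Var_regular_iff:
  "(\<forall>g :: ('i, 'a::field) mpoly. Var i0 * g \<in> tangent_ideal n \<longrightarrow> g \<in> tangent_ideal n) \<longleftrightarrow>
   (\<forall>u. longest n u \<longrightarrow> longest n (Poly_Mapping.single i0 1 + u))"
proof (intro iffI allI impI)
  let ?e = "Poly_Mapping.single i0 1 :: 'i \<Rightarrow>\<^sub>0 nat"
  fix u assume reg: "\<forall>g :: ('i, 'a) mpoly. Var i0 * g \<in> tangent_ideal n \<longrightarrow> g \<in> tangent_ideal n"
    and u: "longest n u"
  show "longest n (?e + u)"
  proof (rule ccontr)
    assume "\<not> longest n (?e + u)"
    then have "Var i0 * Poly_Mapping.single u 1 \<in> (tangent_ideal n :: ('i, 'a) mpoly set)"
      using single_in_tangent_ideal by (simp add: Var_def monomial_def mult_single)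
    then have "Poly_Mapping.single u (1::'a) \<in> tangent_ideal n" using reg by blast
    then have "coeff_sum (longest_exps n (weight n u)) (Poly_Mapping.single u (1::'a)) = 0"
      unfolding tangent_ideal_def by blast
    then show False using u by simp
  qed
next
  let ?e = "Poly_Mapping.single i0 1 :: 'i \<Rightarrow>\<^sub>0 nat"
  fix g :: "('i, 'a) mpoly"
  assume l: "\<forall>u. longest n u \<longrightarrow> longest n (?e + u)" and g: "Var i0 * g \<in> tangent_ideal n"
  have "coeff_sum (longest_exps n s) g = 0" for s
  proof (cases "longest_exps n s = {}")
    case False
    then obtain w where w: "longest n w" "weight n w = s" by auto
    then have "{u. ?e + u \<in> longest_exps n (weight n (?e + w))} = longest_exps n s"
      using shift_longest_exps[of n ?e w] l by simp
    moreover have "coeff_sum (longest_exps n (weight n (?e + w))) (Var i0 * g) = 0"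
      using g unfolding tangent_ideal_def by blast
    ultimately show ?thesis by (simp add: Var_def monomial_def coeff_sum_single_mult)
  qed (simp only: coeff_sum_empty)
  then show "g \<in> tangent_ideal n" by (simp add: tangent_ideal_def)
qed

text \<open>
  A longest vector of a weight \<open>n\<^sub>0 + s\<close> that uses \<open>x\<^sub>0\<close> arises from a longest vector of weight \<open>s\<close>. So
  adding \<open>x\<^sub>0\<close> preserves longest vectors iff every weight in \<open>n\<^sub>0 + S\<close> has a longest vector that uses
  \<open>x\<^sub>0\<close>.
\<close>

lemma longest_step_iff:
  "(\<forall>u. longest n u \<longrightarrow> longest n (Poly_Mapping.single i0 1 + u)) \<longleftrightarrow>
   (\<forall>u v. Poly_Mapping.lookup u i0 = 0 \<and> 0 < Poly_Mapping.lookup v i0 \<and> weight n v = weight n u \<longrightarrow>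
     (\<exists>v. 0 < Poly_Mapping.lookup v i0 \<and> weight n v = weight n u \<and> mon_deg u \<le> mon_deg v))"
  (is "?step \<longleftrightarrow> ?exchange")
proof (intro iffI allI impI)
  let ?e = "Poly_Mapping.single i0 1 :: 'i \<Rightarrow>\<^sub>0 nat"
  fix u v :: "'i \<Rightarrow>\<^sub>0 nat"
  assume ?step and uv: "Poly_Mapping.lookup u i0 = 0 \<and> 0 < Poly_Mapping.lookup v i0 \<and> weight n v = weight n u"
  have "1 \<le> Poly_Mapping.lookup v i0" using uv by simp
  from exponent_split[OF this] obtain w where w: "v = ?e + w" by metis
  obtain w' where w': "longest n w'" "weight n w' = weight n w" using longest_exists by blast
  then have "longest n (?e + w')" using \<open>?step\<close> by blast
  moreover have "weight n (?e + w') = weight n u" using uv w w' by (simp add: weight_add)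
  ultimately have "mon_deg u \<le> mon_deg (?e + w')" unfolding longest_def by simp
  then show "\<exists>v. 0 < Poly_Mapping.lookup v i0 \<and> weight n v = weight n u \<and> mon_deg u \<le> mon_deg v"
    using \<open>weight n (?e + w') = weight n u\<close>
    by (intro exI[of _ "?e + w'"]) (simp add: lookup_add)
next
  let ?e = "Poly_Mapping.single i0 1 :: 'i \<Rightarrow>\<^sub>0 nat"
  fix u :: "'i \<Rightarrow>\<^sub>0 nat" assume ?exchange and u: "longest n u"
  obtain v where v: "longest n v" "weight n v = weight n (?e + u)" using longest_exists by blast
  have "\<exists>v. 0 < Poly_Mapping.lookup v i0 \<and> weight n v = weight n (?e + u) \<and> longest n v"
  proof (cases "Poly_Mapping.lookup v i0 = 0")
    case True
    have "0 < Poly_Mapping.lookup (?e + u) i0" by (simp add: lookup_add)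
    then obtain v' where "0 < Poly_Mapping.lookup v' i0" "weight n v' = weight n v" "mon_deg v \<le> mon_deg v'"
      using \<open>?exchange\<close> True v(2) by metis
    then show ?thesis using longest_mon_deg_ge[OF v(1)] v(2) by metis
  qed (use v in auto)
  then obtain v where v: "1 \<le> Poly_Mapping.lookup v i0" "weight n v = weight n (?e + u)" "longest n v"
    by (auto simp: Suc_le_eq)
  from exponent_split[OF v(1)] obtain w where w: "v = ?e + w" by metis
  then have "weight n w = weight n u" using v(2) by (simp add: weight_add)
  then have "mon_deg w \<le> mon_deg u" using u unfolding longest_def by simp
  then show "longest n (?e + u)"
    using v(2) by (intro longest_mon_deg_ge[OF v(3)]) (simp_all add: w)
qed

theorem cm_tangent_cone_iff:
  "cm_tangent_cone TYPE('a::field) n \<longleftrightarrow>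
   (\<forall>u v. Poly_Mapping.lookup u i0 = 0 \<and> 0 < Poly_Mapping.lookup v i0 \<and> weight n v = weight n u \<longrightarrow>
     (\<exists>v. 0 < Poly_Mapping.lookup v i0 \<and> weight n v = weight n u \<and> mon_deg u \<le> mon_deg v))"
proof -
  interpret thickened_line "tangent_ideal n :: ('i, 'a) mpoly set" "line_hom i0"
    by (rule thickened_line_tangent_ideal)
  have "line_hom i0 [:0, 1:] = (Var i0 :: ('i, 'a) mpoly)" by simp
  then show ?thesis
    unfolding cm_tangent_cone_def initial_ideal_eq
    using cohen_macaulay_iff Var_regular_iff[where ?'a = 'a] longest_step_iff by simp
qed

end

section \<open>Moves between monomials of equal weight\<close>

text \<open>
  If \<open>I(C)\<close> is generated by binomials, then monomials of equal weight are connected by the moves that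
  these binomials define. In dual form: a set \<open>E\<close> of exponents closed under all moves gives a
  functional that vanishes on all multiples of the generators, hence on the binomial
  \<open>x^u - x^v\<close> of \<open>I(C)\<close>.
\<close>

lemma saturated_set:
  fixes M :: "(('i::finite \<Rightarrow>\<^sub>0 nat) \<times> ('i \<Rightarrow>\<^sub>0 nat)) set"
  assumes gen: "Idl\<^bsub>mpoly_ring\<^esub> ((\<lambda>(p, q). monomial p - monomial q) ` M) = (curve_ideal n :: ('i, 'a::field) mpoly set)"
    and sat: "\<And>p q v. (p, q) \<in> M \<Longrightarrow> v + p \<in> E \<longleftrightarrow> v + q \<in> E"
    and w: "weight n u = weight n v"
  shows "u \<in> E \<longleftrightarrow> v \<in> E"
proof -
  have "(monomial u - monomial v :: ('i, 'a) mpoly) \<in> Idl\<^bsub>mpoly_ring\<^esub> ((\<lambda>(p, q). monomial p - monomial q) ` M)"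
    unfolding gen monomial_diff_in_curve_ideal_iff by (rule w)
  then have "coeff_sum E (monomial u - monomial v :: ('i, 'a) mpoly) = 0"
    by (rule coeff_sum_Idl_eq_0) (auto simp: coeff_sum_diff monomial_def sat)
  then show ?thesis by (auto simp: coeff_sum_diff monomial_def split: if_splits)
qed

section \<open>The exchange property for the five binomials\<close>

text \<open>
  The combinatorial content of the five generators. The assumption \<open>connected\<close> is the connectedness
  by moves, in the form of invariant predicates on exponents.
\<close>

locale bresinsky_2a =
  fixes n1 n2 n3 n4 a1 a2 a3 a4 a12 a13 a23 a24 a31 a34 a41 a42 :: nat
  assumes order: "0 < n1" "n1 < n2" "n2 < n3" "n3 < n4"
    and exponents: "0 < a12" "a12 < a2" "0 < a13" "a13 < a3" "0 < a23" "a23 < a3" "0 < a24" "a24 < a4"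
      "0 < a31" "a31 < a1" "0 < a34" "a34 < a4" "0 < a41" "a41 < a1" "0 < a42" "a42 < a2"
    and f1: "a1 * n1 = a12 * n2 + a13 * n3"
    and f2: "a2 * n2 = a23 * n3 + a24 * n4"
    and f3: "a3 * n3 = a31 * n1 + a34 * n4"
    and f4: "a4 * n4 = a41 * n1 + a42 * n2"
    and f5: "a41 * n1 + a23 * n3 = a12 * n2 + a34 * n4"
    and connected: "\<And>P a b c d a' b' c' d'.
      (\<And>a b c d. P (a + a1) b c d \<longleftrightarrow> P a (b + a12) (c + a13) d) \<Longrightarrow>
      (\<And>a b c d. P a (b + a2) c d \<longleftrightarrow> P a b (c + a23) (d + a24)) \<Longrightarrow>
      (\<And>a b c d. P a b (c + a3) d \<longleftrightarrow> P (a + a31) b c (d + a34)) \<Longrightarrow>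
      (\<And>a b c d. P a b c (d + a4) \<longleftrightarrow> P (a + a41) (b + a42) c d) \<Longrightarrow>
      (\<And>a b c d. P (a + a41) b (c + a23) d \<longleftrightarrow> P a (b + a12) c (d + a34)) \<Longrightarrow>
      a * n1 + b * n2 + c * n3 + d * n4 = a' * n1 + b' * n2 + c' * n3 + d' * n4 \<Longrightarrow>
      P a b c d \<Longrightarrow> P a' b' c' d'"
begin

definition W :: "nat \<Rightarrow> nat \<Rightarrow> nat \<Rightarrow> nat \<Rightarrow> nat" where
  "W a b c d = a * n1 + b * n2 + c * n3 + d * n4"

lemma W_add: "W (a + a') (b + b') (c + c') (d + d') = W a b c d + W a' b' c' d'"
  by (simp add: W_def algebra_simps)

text \<open>The arguments are the exponents of a monomial \<open>x\<^sub>2^b x\<^sub>3^c x\<^sub>4^d\<close>; its weight lies in \<open>n\<^sub>1 + S\<close>.\<close>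

definition uses_x1 :: "nat \<Rightarrow> nat \<Rightarrow> nat \<Rightarrow> bool" where
  "uses_x1 b c d \<longleftrightarrow> (\<exists>a' b' c' d'. 0 < a' \<and> W a' b' c' d' = W 0 b c d)"

definition exchangeable :: "nat \<Rightarrow> nat \<Rightarrow> nat \<Rightarrow> bool" where
  "exchangeable b c d \<longleftrightarrow>
    (\<exists>a' b' c' d'. 0 < a' \<and> W a' b' c' d' = W 0 b c d \<and> b + c + d \<le> a' + b' + c' + d')"

lemma deg_le_W: "b + c + d \<le> W 0 b c d"
proof -
  have "b * 1 + c * 1 + d * 1 \<le> b * n2 + c * n3 + d * n4"
    using order by (intro add_mono mult_le_mono2) auto
  then show ?thesis by (simp add: W_def)
qed

text \<open>
  As \<open>n1\<close> is least, \<open>n4\<close> is greatest and \<open>n2 < n3 < n4\<close>, three of the binomials have a side of strictly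
  larger degree regardless of the exponents.
\<close>

lemma a1_gt: "a12 + a13 < a1"
proof -
  have "(a12 + a13) * n1 < a12 * n2 + a13 * n3"
    using order exponents by (simp add: add_mult_distrib add_strict_mono)
  then show ?thesis using order by (simp flip: f1)
qed

lemma a2_gt: "a23 + a24 < a2"
proof -
  have "(a23 + a24) * n2 < a23 * n3 + a24 * n4"
    using order exponents by (simp add: add_mult_distrib add_strict_mono)
  then show ?thesis using order by (simp flip: f2)
qed

lemma a4_lt: "a4 < a41 + a42"
proof -
  have "a4 * n4 < (a41 + a42) * n4"
    unfolding f4 using order exponents by (simp add: add_mult_distrib add_strict_mono)
  then show ?thesis using order by simp
qed

lemma exchangeableI:
  assumes "0 < a'" "W 0 b c d = W a' b' c' d'" "b + c + d \<le> a' + b' + c' + d'"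
  shows "exchangeable b c d"
  unfolding exchangeable_def using assms by metis

lemma exchangeable_add:
  assumes "exchangeable b c d"
  shows "exchangeable (b + b') (c + c') (d + d')"
proof -
  obtain p q r s where *: "0 < p" "W p q r s = W 0 b c d" "b + c + d \<le> p + q + r + s"
    using assms unfolding exchangeable_def by blast
  show ?thesis
    by (rule exchangeableI[of p _ _ _ "q + b'" "r + c'" "s + d'"])
      (use * W_add[of p 0 q b' r c' s d'] W_add[of 0 0 b b' c c' d d'] in auto)
qed

lemma exchangeable_ge:
  assumes "exchangeable b' c' d'" "b' \<le> b" "c' \<le> c" "d' \<le> d"
  shows "exchangeable b c d"
  using exchangeable_add[OF assms(1), of "b - b'" "c - c'" "d - d'"] assms(2-4) by simp

text \<open>
  By the bounds on the exponents, the binomial \<open>f\<^sub>3\<close> is the only move that applies to either of its terms,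
  so these two are the only monomials of their weight. The same holds for \<open>f\<^sub>5\<close>.
\<close>

lemma fibre_f3:
  assumes "W a b c d = W 0 0 a3 0"
  shows "(a, b, c, d) = (0, 0, a3, 0) \<or> (a, b, c, d) = (a31, 0, 0, a34)"
proof -
  let ?P = "\<lambda>a b c d. (a, b, c, d) = (0, 0, a3, 0) \<or> (a, b, c, d) = (a31, 0, 0, a34)"
  show ?thesis
    by (rule connected[of ?P 0 0 a3 0]) (use exponents assms in \<open>auto simp: W_def\<close>)
qed

lemma fibre_f5:
  assumes "W a b c d = W 0 a12 0 a34"
  shows "(a, b, c, d) = (0, a12, 0, a34) \<or> (a, b, c, d) = (a41, 0, a23, 0)"
proof -
  let ?P = "\<lambda>a b c d. (a, b, c, d) = (0, a12, 0, a34) \<or> (a, b, c, d) = (a41, 0, a23, 0)"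
  show ?thesis
    by (rule connected[of ?P 0 a12 0 a34]) (use exponents assms in \<open>auto simp: W_def\<close>)
qed

lemma exchange_f3: "exchangeable 0 a3 0 \<longleftrightarrow> a3 \<le> a31 + a34"
proof
  assume "exchangeable 0 a3 0"
  then obtain a b c d where *: "0 < a" "W a b c d = W 0 0 a3 0" "a3 \<le> a + b + c + d"
    unfolding exchangeable_def by auto
  then show "a3 \<le> a31 + a34" using fibre_f3[OF *(2)] by auto
next
  assume "a3 \<le> a31 + a34"
  then show "exchangeable 0 a3 0"
    by (intro exchangeableI[of a31 _ _ _ 0 0 a34]) (use exponents f3 in \<open>auto simp: W_def\<close>)
qed

lemma exchange_f5: "exchangeable a12 0 a34 \<longleftrightarrow> a12 + a34 \<le> a41 + a23"
proof
  assume "exchangeable a12 0 a34"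
  then obtain a b c d where *: "0 < a" "W a b c d = W 0 a12 0 a34" "a12 + a34 \<le> a + b + c + d"
    unfolding exchangeable_def by auto
  then show "a12 + a34 \<le> a41 + a23" using fibre_f5[OF *(2)] by auto
next
  assume "a12 + a34 \<le> a41 + a23"
  then show "exchangeable a12 0 a34"
    by (intro exchangeableI[of a41 _ _ _ 0 a23 0]) (use exponents f5 in \<open>auto simp: W_def\<close>)
qed

lemma exchange_f1: "exchangeable a12 a13 0"
  by (rule exchangeableI[of a1 _ _ _ 0 0 0]) (use exponents f1 a1_gt in \<open>auto simp: W_def\<close>)

lemma exchange_f4: "exchangeable 0 0 a4"
  by (rule exchangeableI[of a41 _ _ _ a42 0 0]) (use exponents f4 a4_lt in \<open>auto simp: W_def\<close>)

text \<open>
  A monomial divisible by an exchangeable one is exchangeable, which settles the first four cases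
  of the proof. The move by \<open>f\<^sub>2\<close> towards \<open>x\<^sub>2^a\<^sub>2\<close> raises the degree, which the weight bounds: this
  gives the induction. If nothing applies, the monomial is the only one of its weight, and so it
  contradicts \<open>uses_x1\<close>.
\<close>

lemma exchange_all:
  assumes f3': "exchangeable 0 a3 0" and f5': "exchangeable a12 0 a34"
    and large: "\<And>b c d. a2 \<le> b \<Longrightarrow> c < a13 \<Longrightarrow> d < a34 \<Longrightarrow> uses_x1 b c d \<Longrightarrow> exchangeable b c d"
  shows "uses_x1 b c d \<Longrightarrow> exchangeable b c d"
proof (induction "W 0 b c d - (b + c + d)" arbitrary: b c d rule: less_induct)
  case less
  consider "a3 \<le> c" | "a4 \<le> d" | "a12 \<le> b" "a34 \<le> d" | "a12 \<le> b" "a13 \<le> c"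
    | "a2 \<le> b" "c < a13" "d < a34" | "a23 \<le> c" "a24 \<le> d"
    | "c < a3" "d < a4" "b < a2" "b < a12 \<or> d < a34" "b < a12 \<or> c < a13" "c < a23 \<or> d < a24"
    using exponents by linarith
  then show ?case
  proof cases
    case 5
    then show ?thesis using large less.prems by blast
  next
    case 6
    let ?c = "c - a23" and ?d = "d - a24"
    have W: "W 0 (b + a2) ?c ?d = W 0 b c d"
      using 6 f2 W_add[of 0 0 b 0 ?c a23 ?d a24] W_add[of 0 0 b a2 ?c 0 ?d 0] by (simp add: W_def)
    have deg: "b + c + d < (b + a2) + ?c + ?d" using 6 a2_gt by linarith
    then have "W 0 (b + a2) ?c ?d - ((b + a2) + ?c + ?d) < W 0 b c d - (b + c + d)"
      using deg_le_W[of "b + a2" ?c ?d] unfolding W by linarith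
    moreover have "uses_x1 (b + a2) ?c ?d" using less.prems unfolding uses_x1_def W .
    ultimately have "exchangeable (b + a2) ?c ?d" by (rule less.hyps)
    then show ?thesis unfolding exchangeable_def W using deg by (meson less_imp_le le_trans)
  next
    case 7
    obtain a' b' c' d' where v: "0 < a'" "W a' b' c' d' = W 0 b c d"
      using less.prems unfolding uses_x1_def by blast
    let ?P = "\<lambda>p q r s. (p, q, r, s) = (0::nat, b, c, d)"
    have "?P a' b' c' d'"
      by (rule connected[of ?P 0 b c d]) (use exponents 7 v in \<open>auto simp: W_def\<close>)
    then show ?thesis using v(1) by simp
  qed (auto intro: exchangeable_ge[OF f3'] exchangeable_ge[OF f5'] exchangeable_ge[OF exchange_f1]
        exchangeable_ge[OF exchange_f4])
qed

theorem exchange_iff: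
  "(\<forall>b c d. uses_x1 b c d \<longrightarrow> exchangeable b c d) \<longleftrightarrow>
    a3 \<le> a31 + a34 \<and> a12 + a34 \<le> a41 + a23 \<and>
    (\<forall>b c d. a2 \<le> b \<and> c < a13 \<and> d < a34 \<and> uses_x1 b c d \<longrightarrow> exchangeable b c d)"
proof -
  have "uses_x1 0 a3 0" unfolding uses_x1_def
    by (intro exI[of _ a31] exI[of _ 0] exI[of _ a34]) (use exponents f3 in \<open>simp add: W_def\<close>)
  moreover have "uses_x1 a12 0 a34" unfolding uses_x1_def
    by (intro exI[of _ a41] exI[of _ 0] exI[of _ a23]) (use exponents f5 in \<open>simp add: W_def\<close>)
  ultimately show ?thesis
    unfolding exchange_f3[symmetric] exchange_f5[symmetric] using exchange_all by blast
qed

end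

section \<open>Curves in affine four-space\<close>

lemma exhaust_4: "x = 1 \<or> x = 2 \<or> x = 3 \<or> x = 4" for x :: 4
proof (induct x)
  case (of_int z)
  then have "z = 0 \<or> z = 1 \<or> z = 2 \<or> z = 3" by auto
  then show ?case by auto
qed

lemma UNIV_4: "UNIV = {1, 2, 3, 4 :: 4}"
  using exhaust_4 by auto

definition expo :: "nat \<Rightarrow> nat \<Rightarrow> nat \<Rightarrow> nat \<Rightarrow> 4 \<Rightarrow>\<^sub>0 nat" where
  "expo a b c d = Poly_Mapping.single 1 a + Poly_Mapping.single 2 b + Poly_Mapping.single 3 c + Poly_Mapping.single 4 d"

lemma lookup_expo [simp]:
  "Poly_Mapping.lookup (expo a b c d) 1 = a" "Poly_Mapping.lookup (expo a b c d) 2 = b"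
  "Poly_Mapping.lookup (expo a b c d) 3 = c" "Poly_Mapping.lookup (expo a b c d) 4 = d"
  by (simp_all add: expo_def lookup_add lookup_single)

lemma expo_lookup: "expo (Poly_Mapping.lookup u 1) (Poly_Mapping.lookup u 2) (Poly_Mapping.lookup u 3) (Poly_Mapping.lookup u 4) = u"
proof (rule poly_mapping_eqI)
  fix i show "Poly_Mapping.lookup (expo (Poly_Mapping.lookup u 1) (Poly_Mapping.lookup u 2) (Poly_Mapping.lookup u 3) (Poly_Mapping.lookup u 4)) i = Poly_Mapping.lookup u i"
    using exhaust_4[of i] by auto
qed

lemma expo_add: "expo a b c d + expo a' b' c' d' = expo (a + a') (b + b') (c + c') (d + d')"
  by (simp add: expo_def single_add algebra_simps)

lemma weight_expo: "weight n (expo a b c d) = a * n 1 + b * n 2 + c * n 3 + d * n 4"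
  by (simp add: expo_def weight_add)

lemma mon_deg_expo: "mon_deg (expo a b c d) = a + b + c + d"
  by (simp add: expo_def)

lemma Var_powers_expo:
  "Var 1 ^ a = monomial (expo a 0 0 0)" "Var 2 ^ b = monomial (expo 0 b 0 0)"
  "Var 3 ^ c = monomial (expo 0 0 c 0)" "Var 4 ^ d = monomial (expo 0 0 0 d)"
  by (simp_all add: Var_power expo_def)

lemma weight_in_curve_semigroup: "weight n u \<in> curve_semigroup n"
  unfolding curve_semigroup_def weight_def by (intro CollectI exI[of _ "Poly_Mapping.lookup u"]) simp

lemma curve_semigroup_4:
  assumes "m \<in> curve_semigroup n"
  obtains a b c d where "m = weight n (expo a b c d)"
proof -
  obtain g where g: "m = (\<Sum>i\<in>UNIV. g i * n i)"
    using assms unfolding curve_semigroup_def by (elim CollectE exE conjE)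
  have "(\<Sum>i\<in>UNIV. g i * n i) = weight n (expo (g 1) (g 2) (g 3) (g 4))"
    unfolding weight_expo UNIV_4 by simp
  then show ?thesis using that g by metis
qed

theorem proposition3p16:
  fixes n :: "4 \<Rightarrow> nat"
    and a\<^sub>1 a\<^sub>2 a\<^sub>3 a\<^sub>4 a\<^sub>1\<^sub>2 a\<^sub>1\<^sub>3 a\<^sub>2\<^sub>3 a\<^sub>2\<^sub>4 a\<^sub>3\<^sub>1 a\<^sub>3\<^sub>4 a\<^sub>4\<^sub>1 a\<^sub>4\<^sub>2 :: nat
  assumes pos: "\<forall>i. n i > 0"
    and gcd: "Gcd (range n) = 1"
    and order: "n 1 < n 2" "n 2 < n 3" "n 3 < n 4"
    and gorenstein: "gorenstein_curve n"
    and not_ci: "\<not> complete_intersection_curve TYPE('a::field) n"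
    and exponents:
      "0 < a\<^sub>1\<^sub>2" "a\<^sub>1\<^sub>2 < a\<^sub>2" "0 < a\<^sub>1\<^sub>3" "a\<^sub>1\<^sub>3 < a\<^sub>3" "0 < a\<^sub>2\<^sub>3" "a\<^sub>2\<^sub>3 < a\<^sub>3" "0 < a\<^sub>2\<^sub>4" "a\<^sub>2\<^sub>4 < a\<^sub>4"
      "0 < a\<^sub>3\<^sub>1" "a\<^sub>3\<^sub>1 < a\<^sub>1" "0 < a\<^sub>3\<^sub>4" "a\<^sub>3\<^sub>4 < a\<^sub>4" "0 < a\<^sub>4\<^sub>1" "a\<^sub>4\<^sub>1 < a\<^sub>1" "0 < a\<^sub>4\<^sub>2" "a\<^sub>4\<^sub>2 < a\<^sub>2"
    and case_2a: "minimally_generates mpoly_ring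
      {Var 1 ^ a\<^sub>1 - Var 2 ^ a\<^sub>1\<^sub>2 * Var 3 ^ a\<^sub>1\<^sub>3,
       Var 2 ^ a\<^sub>2 - Var 3 ^ a\<^sub>2\<^sub>3 * Var 4 ^ a\<^sub>2\<^sub>4,
       Var 3 ^ a\<^sub>3 - Var 1 ^ a\<^sub>3\<^sub>1 * Var 4 ^ a\<^sub>3\<^sub>4,
       Var 4 ^ a\<^sub>4 - Var 1 ^ a\<^sub>4\<^sub>1 * Var 2 ^ a\<^sub>4\<^sub>2,
       Var 1 ^ a\<^sub>4\<^sub>1 * Var 3 ^ a\<^sub>2\<^sub>3 - Var 2 ^ a\<^sub>1\<^sub>2 * Var 4 ^ a\<^sub>3\<^sub>4}
      (curve_ideal n :: (4, 'a) mpoly set)"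
  shows "cm_tangent_cone TYPE('a) n \<longleftrightarrow>
    a\<^sub>3 \<le> a\<^sub>3\<^sub>1 + a\<^sub>3\<^sub>4 \<and>
    a\<^sub>1\<^sub>2 + a\<^sub>3\<^sub>4 \<le> a\<^sub>4\<^sub>1 + a\<^sub>2\<^sub>3 \<and>
    (\<forall>u\<^sub>2 u\<^sub>3 u\<^sub>4. a\<^sub>2 \<le> u\<^sub>2 \<and> u\<^sub>3 < a\<^sub>1\<^sub>3 \<and> u\<^sub>4 < a\<^sub>3\<^sub>4 \<and>
        u\<^sub>2 * n 2 + u\<^sub>3 * n 3 + u\<^sub>4 * n 4 \<in> (\<lambda>m. n 1 + m) ` curve_semigroup n \<longrightarrow>
      (\<exists>v. 1 \<in> Poly_Mapping.keys v \<and>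
           Var 2 ^ u\<^sub>2 * Var 3 ^ u\<^sub>3 * Var 4 ^ u\<^sub>4 - monomial v \<in> (curve_ideal n :: (4, 'a) mpoly set) \<and>
           u\<^sub>2 + u\<^sub>3 + u\<^sub>4 \<le> mon_deg v))"
proof -
  define M where "M = {(expo a\<^sub>1 0 0 0, expo 0 a\<^sub>1\<^sub>2 a\<^sub>1\<^sub>3 0), (expo 0 a\<^sub>2 0 0, expo 0 0 a\<^sub>2\<^sub>3 a\<^sub>2\<^sub>4),
    (expo 0 0 a\<^sub>3 0, expo a\<^sub>3\<^sub>1 0 0 a\<^sub>3\<^sub>4), (expo 0 0 0 a\<^sub>4, expo a\<^sub>4\<^sub>1 a\<^sub>4\<^sub>2 0 0),
    (expo a\<^sub>4\<^sub>1 0 a\<^sub>2\<^sub>3 0, expo 0 a\<^sub>1\<^sub>2 0 a\<^sub>3\<^sub>4)}"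
  have gen: "Idl\<^bsub>mpoly_ring\<^esub> ((\<lambda>(p, q). monomial p - monomial q) ` M) = (curve_ideal n :: (4, 'a) mpoly set)"
    using case_2a[unfolded minimally_generates_def, THEN conjunct2, THEN conjunct1]
    unfolding Var_powers_expo monomial_mult expo_add M_def by simp
  have "weight n p = weight n q" if "(p, q) \<in> M" for p q
  proof -
    have "(monomial p - monomial q :: (4, 'a) mpoly) \<in> curve_ideal n"
      unfolding gen[symmetric] by (rule subsetD[OF Idl_type_superset]) (use that in force)
    then show ?thesis by (simp add: monomial_diff_in_curve_ideal_iff)
  qed
  then have "\<forall>(p, q)\<in>M. weight n p = weight n q" by blast
  then have eqs: "a\<^sub>1 * n 1 = a\<^sub>1\<^sub>2 * n 2 + a\<^sub>1\<^sub>3 * n 3" "a\<^sub>2 * n 2 = a\<^sub>2\<^sub>3 * n 3 + a\<^sub>2\<^sub>4 * n 4"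
    "a\<^sub>3 * n 3 = a\<^sub>3\<^sub>1 * n 1 + a\<^sub>3\<^sub>4 * n 4" "a\<^sub>4 * n 4 = a\<^sub>4\<^sub>1 * n 1 + a\<^sub>4\<^sub>2 * n 2"
    "a\<^sub>4\<^sub>1 * n 1 + a\<^sub>2\<^sub>3 * n 3 = a\<^sub>1\<^sub>2 * n 2 + a\<^sub>3\<^sub>4 * n 4"
    unfolding M_def by (simp_all add: weight_expo)
  interpret bresinsky_2a "n 1" "n 2" "n 3" "n 4" a\<^sub>1 a\<^sub>2 a\<^sub>3 a\<^sub>4 a\<^sub>1\<^sub>2 a\<^sub>1\<^sub>3 a\<^sub>2\<^sub>3 a\<^sub>2\<^sub>4 a\<^sub>3\<^sub>1 a\<^sub>3\<^sub>4 a\<^sub>4\<^sub>1 a\<^sub>4\<^sub>2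
  proof (rule bresinsky_2a.intro)
    fix P :: "nat \<Rightarrow> nat \<Rightarrow> nat \<Rightarrow> nat \<Rightarrow> bool" and a b c d a' b' c' d'
    assume moves:
      "\<And>a b c d. P (a + a\<^sub>1) b c d \<longleftrightarrow> P a (b + a\<^sub>1\<^sub>2) (c + a\<^sub>1\<^sub>3) d"
      "\<And>a b c d. P a (b + a\<^sub>2) c d \<longleftrightarrow> P a b (c + a\<^sub>2\<^sub>3) (d + a\<^sub>2\<^sub>4)"
      "\<And>a b c d. P a b (c + a\<^sub>3) d \<longleftrightarrow> P (a + a\<^sub>3\<^sub>1) b c (d + a\<^sub>3\<^sub>4)"
      "\<And>a b c d. P a b c (d + a\<^sub>4) \<longleftrightarrow> P (a + a\<^sub>4\<^sub>1) (b + a\<^sub>4\<^sub>2) c d"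
      "\<And>a b c d. P (a + a\<^sub>4\<^sub>1) b (c + a\<^sub>2\<^sub>3) d \<longleftrightarrow> P a (b + a\<^sub>1\<^sub>2) c (d + a\<^sub>3\<^sub>4)"
      and w: "a * n 1 + b * n 2 + c * n 3 + d * n 4 = a' * n 1 + b' * n 2 + c' * n 3 + d' * n 4"
      and P: "P a b c d"
    let ?E = "{u. P (Poly_Mapping.lookup u 1) (Poly_Mapping.lookup u 2) (Poly_Mapping.lookup u 3) (Poly_Mapping.lookup u 4)}"
    have "expo a b c d \<in> ?E \<longleftrightarrow> expo a' b' c' d' \<in> ?E"
      by (rule saturated_set[OF gen]) (use moves w in \<open>auto simp: M_def lookup_add weight_expo\<close>)
    then show "P a' b' c' d'" using P by simp
  qed (use pos order exponents eqs in \<open>simp_all\<close>)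
  have W: "W a b c d = weight n (expo a b c d)" for a b c d
    by (simp add: W_def weight_expo)
  interpret C: curve_with_least_generator n 1
  proof
    fix i :: 4 assume "i \<noteq> 1"
    then show "n 1 < n i" using exhaust_4[of i] order by auto
  qed (use pos in simp)
  have uses: "uses_x1 b c d \<longleftrightarrow> b * n 2 + c * n 3 + d * n 4 \<in> (\<lambda>m. n 1 + m) ` curve_semigroup n"
    for b c d
  proof
    assume "uses_x1 b c d"
    then obtain a' b' c' d' where v: "0 < a'" "W a' b' c' d' = W 0 b c d"
      unfolding uses_x1_def by blast
    then obtain a where a: "a' = Suc a" by (cases a') auto
    have "b * n 2 + c * n 3 + d * n 4 = n 1 + weight n (expo a b' c' d')"
      using v(2) by (simp add: a W_def weight_expo)
    then show "b * n 2 + c * n 3 + d * n 4 \<in> (\<lambda>m. n 1 + m) ` curve_semigroup n"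
      using weight_in_curve_semigroup by (rule image_eqI)
  next
    assume "b * n 2 + c * n 3 + d * n 4 \<in> (\<lambda>m. n 1 + m) ` curve_semigroup n"
    then obtain a' b' c' d' where "b * n 2 + c * n 3 + d * n 4 = n 1 + weight n (expo a' b' c' d')"
      by (elim imageE) (metis curve_semigroup_4)
    then have "W (Suc a') b' c' d' = W 0 b c d" by (simp add: W_def weight_expo)
    then show "uses_x1 b c d" unfolding uses_x1_def by blast
  qed
  have ex: "exchangeable b c d \<longleftrightarrow> (\<exists>v. 0 < Poly_Mapping.lookup v 1 \<and>
      weight n v = weight n (expo 0 b c d) \<and> b + c + d \<le> mon_deg v)" for b c d
    unfolding exchangeable_def W by (metis lookup_expo(1) expo_lookup mon_deg_expo)
  have cm: "cm_tangent_cone TYPE('a) n \<longleftrightarrow> (\<forall>b c d. uses_x1 b c d \<longrightarrow> exchangeable b c d)"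
    unfolding C.cm_tangent_cone_iff
  proof (intro iffI allI impI)
    fix b c d
    assume *: "\<forall>u v. Poly_Mapping.lookup u 1 = 0 \<and> 0 < Poly_Mapping.lookup v 1 \<and> weight n v = weight n u \<longrightarrow>
      (\<exists>v. 0 < Poly_Mapping.lookup v 1 \<and> weight n v = weight n u \<and> mon_deg u \<le> mon_deg v)"
    assume "uses_x1 b c d"
    then obtain a' b' c' d' where "0 < a'" "W a' b' c' d' = W 0 b c d"
      unfolding uses_x1_def by blast
    then show "exchangeable b c d"
      using *[rule_format, of "expo 0 b c d" "expo a' b' c' d'"] unfolding ex by (simp add: W mon_deg_expo)
  next
    fix u v
    assume *: "\<forall>b c d. uses_x1 b c d \<longrightarrow> exchangeable b c d"
    assume uv: "Poly_Mapping.lookup u 1 = 0 \<and> 0 < Poly_Mapping.lookup v 1 \<and> weight n v = weight n u"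
    obtain b c d where u: "u = expo 0 b c d" using uv expo_lookup[of u] by metis
    have "uses_x1 b c d" unfolding uses_x1_def W using uv expo_lookup[of v] unfolding u by metis
    then have "exchangeable b c d" using * by blast
    then show "\<exists>v. 0 < Poly_Mapping.lookup v 1 \<and> weight n v = weight n u \<and> mon_deg u \<le> mon_deg v"
      unfolding ex u mon_deg_expo by simp
  qed
  have "exchangeable b c d \<longleftrightarrow> (\<exists>v. 1 \<in> Poly_Mapping.keys v \<and>
           Var 2 ^ b * Var 3 ^ c * Var 4 ^ d - monomial v \<in> (curve_ideal n :: (4, 'a) mpoly set) \<and>
           b + c + d \<le> mon_deg v)" for b c d
    unfolding ex Var_powers_expo monomial_mult expo_add monomial_diff_in_curve_ideal_iff
    by (simp add: in_keys_iff) metis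
  then show ?thesis unfolding cm unfolding exchange_iff unfolding uses by (simp only:)
qed

end
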